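(* Let $m,n$ be positive integers with $n\ge m$, and let $$\Theta_1=\sum_{k=1}^\infty \frac{\psi\left(\frac{2k+2n+5}{4}\right)-\psi\left(\frac{2k+2n+3}{4}\right)}{(2k+2m)^2}.$$ Then: (i) if $n=m$: $$\Theta_1=-4-\sum_{k=1}^m\sum_{j=0}^k\frac{(-1)^{k+j}}{k^2(2j+1)}+4\ln 2-\left(\frac12\ln^2 2+\sum_{k=1}^m\frac{(-1)^{k-1}}{4k^2}\right)\pi+\frac{\pi^2}{6}-\frac{11\pi^3}{48}-4G\ln 2+8\,\Im(\mathrm{Li}_3(1+i));$$ (ii) if $n=m+1$: $$\Theta_1=\frac{92}{27}+\sum_{k=1}^m\sum_{j=0}^{k+1}\frac{(-1)^{k+j}}{k^2(2j+1)}+\left(\frac12\ln^2 2-\sum_{k=1}^m\frac{(-1)^k}{4k^2}\right)\pi-\frac{\pi^2}{9}+\frac{11\pi^3}{48}+4G\ln 2-\frac{32\ln 2}{9}-8\,\Im(\mathrm{Li}_3(1+i));$$ (iii) if $n-m$ is odd and $n-m\ne1$: $$\begin{aligned}\Theta_1={}&\frac{92}{27}+16\sum_{j=1}^{\frac{n-m-1}{2}}\frac{(2j+1)(2H_{4j+1}-H_{2j})}{(4j+3)^2(4j+1)^2}-4\sum_{j=1}^{\frac{n-m-1}{2}}\frac{1}{(4j+3)^3}-\sum_{k=1}^m\sum_{j=0}^{k+n-m}\frac{(-1)^{j+k+n-m}}{k^2(2j+1)}\\&+\left(\frac12\ln^2 2+(-1)^{n-m}\sum_{k=1}^m\frac{(-1)^k}{4k^2}\right)\pi-\pi^2\left(\frac19+\frac13\sum_{j=1}^{\frac{n-m-1}{2}}\frac{1}{(4j+3)(4j+1)}\right)\\&-\ln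 2\left(\frac{32}{9}+32\sum_{j=1}^{\frac{n-m-1}{2}}\frac{2j+1}{(4j+3)^2(4j+1)^2}\right)+\frac{11\pi^3}{48}+4G\ln 2-8\,\Im(\mathrm{Li}_3(1+i));\end{aligned}$$ (iv) if $n-m$ is even: $$\begin{aligned}\Theta_1={}&-4+32\sum_{j=0}^{\frac{n-m-2}{2}}\frac{(j+1)(2H_{4j+3}-H_{2j+1})}{(4j+5)^2(4j+3)^2}-4\sum_{j=0}^{\frac{n-m-2}{2}}\frac{1}{(4j+5)^3}-\sum_{k=1}^m\sum_{j=0}^{k+n-m}\frac{(-1)^{j+k+n-m}}{k^2(2j+1)}\\&+\left(-\frac12\ln^2 2+(-1)^{n-m}\sum_{k=1}^m\frac{(-1)^k}{4k^2}\right)\pi+\pi^2\left(\frac16-\frac13\sum_{j=0}^{\frac{n-m-2}{2}}\frac{1}{(4j+5)(4j+3)}\right)\\&+\ln 2\left(4-64\sum_{j=0}^{\frac{n-m-2}{2}}\frac{j+1}{(4j+5)^2(4j+3)^2}\right)-\frac{11\pi^3}{48}-4G\ln 2+8\,\Im(\mathrm{Li}_3(1+i)).\end{aligned}$$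
   Context: $\psi=\Gamma'/\Gamma$ is the digamma function, $H_n=\sum_{k=1}^n\frac1k$ the $n$-th harmonic number, $G=\sum_{k=0}^\infty\frac{(-1)^k}{(2k+1)^2}$ is Catalan's constant, and $\mathrm{Li}_3$ is the trilogarithm, $\mathrm{Li}_3(z)=\sum_{k\ge1}z^k/k^3$ for $|z|\le1$, analytically continued to $\mathbb C\setminus[1,\infty)$ (principal branch); $\Im(\mathrm{Li}_3(1+i))\approx1.2670834419$. Empty sums (such as $\sum_{j=0}^{-1}$) are $0$. *)

theory Defs
  imports "HOL-Complex_Analysis.Complex_Analysis" "HOL-Analysis.Harmonic_Numbers"
begin

definition catalan :: real where
  "catalan = (\<Sum>k. (-1) ^ k / (2 * real k + 1)\<^sup>2)"

abbreviation slit_plane :: "complex set" where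
  "slit_plane \<equiv> - (complex_of_real ` {1..})"

definition trilog_series :: "complex \<Rightarrow> complex" where
  "trilog_series z = (\<Sum>k. z ^ Suc k / of_nat (Suc k) ^ 3)"

text \<open>
  Outside the closed unit disc, the trilogarithm is the analytic continuation of its power series
  to the slit plane. A continuation exists, by \<open>trilog_continuation_exists\<close> below, and its values
  on the slit plane are unique, so that there \<open>SOME\<close> makes no arbitrary choice; on the cut outside
  the closed unit disc the value of \<open>trilog\<close> is unspecified.
\<close>

definition trilog_continuation :: "(complex \<Rightarrow> complex) \<Rightarrow> bool" where
  "trilog_continuation f \<longleftrightarrow> f holomorphic_on slit_plane \<and> (\<forall>z\<in>ball 0 1. f z = trilog_series z)"

definition trilog :: "complex \<Rightarrow> complex" where
  "trilog z = (if norm z \<le> 1 then trilog_series z else (SOME f. trilog_continuation f) z)"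

definition Theta1_summand :: "nat \<Rightarrow> nat \<Rightarrow> nat \<Rightarrow> real" where
  "Theta1_summand m n k =
     (Digamma ((2 * real k + 2 * real n + 5) / 4) - Digamma ((2 * real k + 2 * real n + 3) / 4))
       / (2 * real k + 2 * real m)\<^sup>2"

definition Theta1 :: "nat \<Rightarrow> nat \<Rightarrow> real" where
  "Theta1 m n = (\<Sum>k. Theta1_summand m n (Suc k))"

lemma open_slit_plane: "open slit_plane"
  by (intro open_Compl closed_slot_right)

lemma ball_subset_slit_plane: "ball 0 1 \<subseteq> slit_plane"
  by (auto simp: dist_norm)

lemma zero_in_slit_plane: "0 \<in> slit_plane"
  using ball_subset_slit_plane by auto

lemma summable_polylog:
  fixes z :: complex
  assumes "norm z < 1"
  shows "summable (\<lambda>k. (1 / of_nat k ^ p) * z ^ k)"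
proof (rule summable_comparison_test)
  have "norm ((1 / of_nat k ^ p) * z ^ k) \<le> norm z ^ k" for k
  proof -
    have "norm (1 / of_nat k ^ p :: complex) \<le> 1"
    proof (cases "k = 0")
      case True
      thus ?thesis by (cases p) auto
    next
      case False
      hence "1 \<le> real k ^ p" by (intro one_le_power) auto
      thus ?thesis using False by (simp add: norm_divide norm_power divide_le_eq_1)
    qed
    thus ?thesis
      unfolding norm_mult norm_power[of z] by (intro mult_left_le_one_le) auto
  qed
  thus "\<exists>N. \<forall>k\<ge>N. norm ((1 / of_nat k ^ p) * z ^ k) \<le> norm z ^ k" by blast
  show "summable (\<lambda>k. norm z ^ k)"
    using assms by (intro summable_geometric) auto
qed

lemma polylog_continuation_step:
  assumes f: "f holomorphic_on slit_plane"
    and fs: "\<And>z. z \<in> ball 0 1 \<Longrightarrow> f z = (\<Sum>k. (1 / of_nat k ^ p) * z ^ k)"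
    and p: "p \<ge> 1"
  shows "\<exists>g. g holomorphic_on slit_plane \<and>
             (\<forall>z\<in>ball 0 1. g z = (\<Sum>k. (1 / of_nat k ^ Suc p) * z ^ k))"
proof -
  define a where "a = (\<lambda>q k. 1 / of_nat k ^ q :: complex)"
  define F where "F = (\<lambda>q z. \<Sum>k. a q k * z ^ k :: complex)"
  have a0: "a q 0 = 0" if "q \<ge> 1" for q using that by (simp add: a_def)
  have summable_a: "summable (\<lambda>k. a q k * z ^ k)" if "norm z < 1" for q z
    unfolding a_def by (rule summable_polylog[OF that])
  have f0: "f 0 = 0"
    using fs[of 0] a0[OF p] powser_zero[of "a p"] by (simp add: a_def)
  define h where "h = (\<lambda>z. if z = 0 then deriv f 0 else (f z - f 0) / (z - 0))"
  have h: "h holomorphic_on slit_plane"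
    unfolding h_def by (rule pole_lemma_open[OF f open_slit_plane])
  have "\<exists>g. \<forall>x\<in>slit_plane. (g has_field_derivative h x) (at x)"
  proof (rule holomorphic_starlike_primitive)
    show "continuous_on slit_plane h" by (rule holomorphic_on_imp_continuous_on[OF h])
    show "starlike slit_plane" by (rule starlike_slotted_complex_plane_right)
    show "h field_differentiable at x" if "x \<in> slit_plane - {}" for x
      using h open_slit_plane that by (auto intro: holomorphic_on_imp_differentiable_at)
  qed (use open_slit_plane in auto)
  then obtain g where g: "\<And>x. x \<in> slit_plane \<Longrightarrow> (g has_field_derivative h x) (at x)" by blast
  have F': "(F (Suc p) has_field_derivative (\<Sum>k. a p (Suc k) * z ^ k)) (at z)"
    if "norm z < 1" for z
  proof -
    have "diffs (a (Suc p)) = (\<lambda>k. a p (Suc k))"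
      by (simp add: diffs_def a_def fun_eq_iff field_simps del: of_nat_Suc)
    thus ?thesis
      using termdiffs_strong'[of 1 "a (Suc p)" z] summable_a that unfolding F_def by simp
  qed
  have der0: "((\<lambda>z. g z - F (Suc p) z) has_field_derivative 0) (at z)"
    if "z \<in> ball 0 1 - {0}" for z
  proof -
    have z: "norm z < 1" "z \<noteq> 0" "z \<in> slit_plane"
      using that ball_subset_slit_plane by auto
    have "f z = (\<Sum>k. a p k * z ^ k)" using fs that by (simp add: a_def)
    also have "\<dots> = (\<Sum>k. a p (Suc k) * z ^ k) * z"
      using powser_split_head(1)[OF summable_a[OF z(1)], of p] a0[OF p] by simp
    finally have "h z = (\<Sum>k. a p (Suc k) * z ^ k)" using z f0 by (simp add: h_def)
    thus ?thesis using DERIV_diff[OF g[OF z(3)] F'[OF z(1)]] by simp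
  qed
  have cont: "continuous_on (ball 0 1) (\<lambda>z. g z - F (Suc p) z)"
  proof (intro continuous_at_imp_continuous_on ballI)
    fix z :: complex assume "z \<in> ball 0 1"
    hence z: "norm z < 1" "z \<in> slit_plane" using ball_subset_slit_plane by auto
    show "isCont (\<lambda>z. g z - F (Suc p) z) z"
      using DERIV_diff[OF g[OF z(2)] F'[OF z(1)]] by (rule DERIV_isCont)
  qed
  obtain c where c: "\<And>z. z \<in> ball 0 1 \<Longrightarrow> g z - F (Suc p) z = c"
    by (rule DERIV_zero_connected_constant[of "ball 0 1" "{0}" "\<lambda>z. g z - F (Suc p) z"])
       (use cont der0 in auto)
  have "g holomorphic_on slit_plane"
    unfolding holomorphic_on_open[OF open_slit_plane] using g by blast
  hence "(\<lambda>z. g z - c) holomorphic_on slit_plane"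
    by (intro holomorphic_intros)
  moreover have "\<forall>z\<in>ball 0 1. g z - c = (\<Sum>k. (1 / of_nat k ^ Suc p) * z ^ k)"
    using c by (auto simp: F_def a_def algebra_simps)
  ultimately show ?thesis by (intro exI[of _ "\<lambda>z. g z - c"]) blast
qed

theorem trilog_continuation_exists: "\<exists>f. trilog_continuation f"
proof -
  let ?P = "\<lambda>p f. f holomorphic_on slit_plane \<and>
                   (\<forall>z\<in>ball 0 1. f z = (\<Sum>k. (1 / of_nat k ^ p) * z ^ k))"
  have "(\<lambda>z. - Ln (1 - z)) holomorphic_on slit_plane"
  proof (intro holomorphic_intros)
    fix z assume z: "z \<in> slit_plane"
    show "1 - z \<notin> \<real>\<^sub>\<le>\<^sub>0"
    proof
      assume "1 - z \<in> \<real>\<^sub>\<le>\<^sub>0"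
      then obtain r where "1 - z = of_real r" "r \<le> 0" by (auto elim!: nonpos_Reals_cases)
      hence "z = of_real (1 - r)" "1 - r \<ge> 1" by (auto simp: algebra_simps)
      thus False using z by blast
    qed
  qed
  moreover have "- Ln (1 - z) = (\<Sum>k. (1 / of_nat k ^ 1) * z ^ k)" if "z \<in> ball 0 1" for z :: complex
    using sums_minus[OF Ln_series'[of "-z"]] that by (simp add: sums_iff)
  ultimately have "\<exists>f. ?P 1 f" by (intro exI[of _ "\<lambda>z. - Ln (1 - z)"]) auto
  then obtain f1 where "?P 1 f1" by blast
  then obtain f2 where "?P 2 f2"
    using polylog_continuation_step[of f1 1] by (auto simp: numeral_2_eq_2)
  then obtain f where f: "?P 3 f"
    using polylog_continuation_step[of f2 2] by (auto simp: numeral_3_eq_3 numeral_2_eq_2)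
  have "f z = trilog_series z" if "z \<in> ball 0 1" for z
  proof -
    have z: "norm z < 1" using that by simp
    have "f z = (\<Sum>k. (1 / of_nat (Suc k) ^ 3) * z ^ k) * z"
      using f that powser_split_head(1)[OF summable_polylog[OF z], of 3] by simp
    also have "\<dots> = (\<Sum>k. (1 / of_nat (Suc k) ^ 3) * z ^ k * z)"
      by (rule suminf_mult2[OF powser_split_head(3)[OF summable_polylog[OF z]]])
    also have "\<dots> = trilog_series z"
      unfolding trilog_series_def by (rule suminf_cong) simp
    finally show ?thesis .
  qed
  thus ?thesis using f unfolding trilog_continuation_def by blast
qed

lemma trilog_continuation_unique:
  assumes "trilog_continuation f" "trilog_continuation g" "z \<in> slit_plane"
  shows "f z = g z"
proof (rule analytic_continuation_open[of "ball 0 1" slit_plane f g])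
  show "connected slit_plane"
    by (intro starlike_imp_connected starlike_slotted_complex_plane_right)
qed (use assms ball_subset_slit_plane open_slit_plane in \<open>auto simp: trilog_continuation_def\<close>)

lemma trilog_series_continuous: "continuous_on (cball 0 1) trilog_series"
proof -
  have "uniform_limit (cball 0 1) (\<lambda>n z. \<Sum>k<n. z ^ Suc k / of_nat (Suc k) ^ 3)
          (\<lambda>z::complex. \<Sum>k. z ^ Suc k / of_nat (Suc k) ^ 3) sequentially"
  proof (rule Weierstrass_m_test)
    show "norm (z ^ Suc k / of_nat (Suc k) ^ 3) \<le> 1 / real (Suc k) ^ 3"
      if "z \<in> cball 0 1" for k and z :: complex
      using that power_le_one[of "norm z" "Suc k"]
      by (simp only: norm_divide norm_power norm_of_nat) (auto intro!: divide_right_mono)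
    have "summable (\<lambda>k. 1 / real k ^ 3)"
      using inverse_power_summable[of 3, where 'a = real] by (simp add: inverse_eq_divide)
    thus "summable (\<lambda>k. 1 / real (Suc k) ^ 3)" by (subst summable_Suc_iff)
  qed
  hence "continuous_on (cball 0 1) (\<lambda>z::complex. \<Sum>k. z ^ Suc k / of_nat (Suc k) ^ 3)"
    by (rule uniform_limit_theorem[rotated]) (auto intro!: always_eventually continuous_intros simp del: of_nat_Suc)
  thus ?thesis by (simp add: trilog_series_def[abs_def])
qed

lemma trilog_continuation_eq:
  assumes f: "trilog_continuation f" and z: "z \<in> slit_plane"
  shows "trilog z = f z"
proof (cases "norm z \<le> 1")
  case False
  have "trilog_continuation (SOME f. trilog_continuation f)"
    using trilog_continuation_exists by (rule someI_ex)
  thus ?thesis using False trilog_continuation_unique[OF _ f z] by (simp add: trilog_def)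
next
  case True
  define w where "w = (\<lambda>n. of_real (1 - 1 / real (n + 2)) * z)"
  have nw: "norm (w n) < 1" for n
  proof -
    have "norm (w n) = (1 - 1 / real (n + 2)) * norm z"
      unfolding w_def norm_mult norm_of_real by simp
    also have "\<dots> \<le> (1 - 1 / real (n + 2)) * 1"
      using True by (intro mult_left_mono) auto
    also have "\<dots> < 1" by simp
    finally show ?thesis .
  qed
  have "w \<longlonglongrightarrow> of_real (1 - 0) * z"
    unfolding w_def
    by (intro tendsto_intros LIMSEQ_ignore_initial_segment[OF lim_1_over_n])
  hence w: "w \<longlonglongrightarrow> z" by simp
  have "isCont f z"
    using f z open_slit_plane holomorphic_on_imp_continuous_on continuous_on_eq_continuous_at
    unfolding trilog_continuation_def by blast
  hence 1: "(\<lambda>n. f (w n)) \<longlonglongrightarrow> f z" using w by (rule isCont_tendsto_compose)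
  have 2: "(\<lambda>n. trilog_series (w n)) \<longlonglongrightarrow> trilog_series z"
    by (rule continuous_on_tendsto_compose[OF trilog_series_continuous w])
       (use True nw in \<open>auto intro!: always_eventually less_imp_le\<close>)
  have "(\<lambda>n. f (w n)) = (\<lambda>n. trilog_series (w n))"
    using f nw by (auto simp: trilog_continuation_def)
  thus ?thesis using 1 2 LIMSEQ_unique True by (auto simp: trilog_def)
qed

lemma trilog_holomorphic: "trilog holomorphic_on slit_plane"
  using trilog_continuation_exists trilog_continuation_eq
  by (metis holomorphic_transform trilog_continuation_def)

end

theory Submission
  imports Defs "HOL-Real_Asymp.Real_Asymp"
begin

text \<open>
  The digamma difference is four times the moment of \<open>x ^ (2 * l)\<close> against \<open>1 / (1 + x\<^sup>2)\<close> on the unit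
  interval, so up to finitely many terms the series is the sum \<open>S d\<close> of the moments of index \<open>l + d + 1\<close>
  divided by \<open>l\<^sup>2\<close>, where \<open>d = n - m\<close>. Since two consecutive moments add up to \<open>1 / (2 * l + 1)\<close>,
  the sum of \<open>S d\<close> and \<open>S (d + 1)\<close> is elementary, which reduces everything to \<open>d = 0\<close>, that is, to the
  integral of \<open>Li\<^sub>2 (x\<^sup>2) / (1 + x\<^sup>2)\<close> over the unit interval. Integration by parts turns this integral into
  that of \<open>arctan x * ln (1 - x\<^sup>2) / x\<close>. With \<open>v = Ln (1 + \<i> * x)\<close>, \<open>a = ln (1 - x)\<close> and \<open>b = ln (1 + x)\<close>, the
  numerator is half the imaginary part of \<open>2 * v\<^sup>2 - (a - v)\<^sup>2 - (v - b)\<^sup>2\<close>, and each of these squares is the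
  squared logarithm of a Moebius transform of \<open>x\<close>. The resulting integrals of \<open>Ln w ^ 2 / (w - 1)\<close> and
  \<open>Ln w ^ 2 / (w - \<i>)\<close> are trilogarithmic; inversion, complex conjugation and the reflection
  formula of the dilogarithm reduce their end point values to \<open>Li\<^sub>3 (1 + \<i>)\<close>.
\<close>

subsection \<open>The dilogarithm on the slit plane\<close>

definition polylog_series :: "nat \<Rightarrow> complex \<Rightarrow> complex" where
  "polylog_series p z = (\<Sum>k. z ^ Suc k / of_nat (Suc k) ^ p)"

text \<open>Defined by differentiation, the dilogarithm inherits its continuation to the slit plane.
  Only the values there are meaningful.\<close>

definition dilog :: "complex \<Rightarrow> complex" where
  "dilog z = z * deriv trilog z"

section \<open>Polylogarithm series on the closed unit disc\<close>

lemma summable_inverse_power_Suc: "p \<ge> 2 \<Longrightarrow> summable (\<lambda>k. 1 / real (Suc k) ^ p)"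
  using inverse_power_summable[of p, where 'a = real]
  by (subst summable_Suc_iff) (simp add: inverse_eq_divide)

lemma polylog_series_term_bound:
  assumes "norm z \<le> 1"
  shows "norm (z ^ Suc k / of_nat (Suc k) ^ p :: complex) \<le> 1 / real (Suc k) ^ p"
  using assms power_le_one[of "norm z" "Suc k"]
  by (simp only: norm_divide norm_power norm_of_nat) (auto intro!: divide_right_mono)

lemma polylog_series_uniform_limit:
  assumes "p \<ge> 2"
  shows "uniform_limit (cball 0 1) (\<lambda>n z. \<Sum>k<n. z ^ Suc k / of_nat (Suc k) ^ p)
           (polylog_series p) sequentially"
  unfolding polylog_series_def
  by (rule Weierstrass_m_test[OF polylog_series_term_bound summable_inverse_power_Suc[OF assms]]) auto

lemma polylog_series_continuous:
  assumes "p \<ge> 2"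
  shows "continuous_on (cball 0 1) (polylog_series p)"
  by (rule uniform_limit_theorem[rotated, OF polylog_series_uniform_limit[OF assms]])
     (auto intro!: always_eventually continuous_intros simp del: of_nat_Suc)

lemma polylog_series_sums:
  assumes "p \<ge> 2" "norm z \<le> 1"
  shows "(\<lambda>k. z ^ Suc k / of_nat (Suc k) ^ p) sums polylog_series p z"
proof -
  have "summable (\<lambda>k. z ^ Suc k / of_nat (Suc k) ^ p)"
    by (rule summable_comparison_test[OF _ summable_inverse_power_Suc[OF assms(1)]])
       (use polylog_series_term_bound[OF assms(2)] in blast)
  thus ?thesis by (simp add: polylog_series_def sums_iff)
qed

lemma polylog_series_cnj:
  assumes "p \<ge> 2" "norm z \<le> 1"
  shows "polylog_series p (cnj z) = cnj (polylog_series p z)"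
proof -
  have "(\<lambda>k. cnj (z ^ Suc k / of_nat (Suc k) ^ p)) sums cnj (polylog_series p z)"
    using polylog_series_sums[OF assms] by (simp only: sums_cnj)
  thus ?thesis
    using polylog_series_sums[of p "cnj z"] assms sums_unique2 by (simp del: of_nat_Suc power_Suc) blast
qed

text \<open>Together the two parts say that \<open>z\<close> times the derivative of the series of
  order \<open>Suc p\<close> is the series of order \<open>p\<close>. Keeping the quotient by
  \<open>z\<close> as a series of its own covers the point 0 as well.\<close>

lemma polylog_series_deriv:
  assumes z: "norm z < 1"
  shows "(polylog_series (Suc p) has_field_derivative (\<Sum>k. z ^ k / of_nat (Suc k) ^ p)) (at z)"
    and "polylog_series p z = z * (\<Sum>k. z ^ k / of_nat (Suc k) ^ p)"
proof -
  define a :: "nat \<Rightarrow> nat \<Rightarrow> complex" where "a = (\<lambda>q k. 1 / of_nat k ^ q)"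
  \<comment> \<open>Division by zero makes the coefficient at index 0 vanish, so the power series
    over all \<open>k\<close> agrees with the series over \<open>Suc k\<close>.\<close>
  have a0: "a (Suc q) 0 = 0" for q by (simp add: a_def)
  have s: "summable (\<lambda>k. a q k * z ^ k)" if "norm z < 1" for q z
    unfolding a_def by (rule summable_polylog[OF that])
  have split: "polylog_series q w = z * (\<Sum>k. w ^ k / of_nat (Suc k) ^ q)"
    if "norm w < 1" "w = z" for q w
  proof -
    have "summable (\<lambda>k. a q (Suc k) * w ^ k)"
      using powser_split_head(3)[OF s[OF that(1)]] .
    hence "z * (\<Sum>k. a q (Suc k) * w ^ k) = (\<Sum>k. z * (a q (Suc k) * w ^ k))"
      by (rule suminf_mult[symmetric])
    thus ?thesis using that by (simp add: polylog_series_def a_def field_simps del: of_nat_Suc)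
  qed
  show "polylog_series p z = z * (\<Sum>k. z ^ k / of_nat (Suc k) ^ p)" by (rule split[OF z refl])
  have "diffs (a (Suc p)) = (\<lambda>k. a p (Suc k))"
    by (simp add: diffs_def a_def fun_eq_iff field_simps del: of_nat_Suc)
  hence d: "((\<lambda>z. \<Sum>k. a (Suc p) k * z ^ k) has_field_derivative (\<Sum>k. a p (Suc k) * z ^ k)) (at z)"
    using termdiffs_strong'[of 1 "a (Suc p)" z] s z by simp
  have "(polylog_series (Suc p) has_field_derivative (\<Sum>k. a p (Suc k) * z ^ k)) (at z)"
  proof (rule has_field_derivative_transform_within_open[OF d, of "ball 0 1"])
    fix w :: complex assume "w \<in> ball 0 1"
    hence w: "norm w < 1" by simp
    show "(\<Sum>k. a (Suc p) k * w ^ k) = polylog_series (Suc p) w"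
      using powser_split_head(1)[OF s[OF w, of "Suc p"]] suminf_mult2[OF powser_split_head(3)[OF s[OF w, of "Suc p"]], of w]
      by (simp add: a0 polylog_series_def a_def mult_ac del: of_nat_Suc)
  qed (use z in auto)
  thus "(polylog_series (Suc p) has_field_derivative (\<Sum>k. z ^ k / of_nat (Suc k) ^ p)) (at z)"
    by (simp add: a_def del: of_nat_Suc)
qed

section \<open>Continuation of the dilogarithm and its derivative\<close>

lemma trilog_eq_series: "norm z \<le> 1 \<Longrightarrow> trilog z = polylog_series 3 z"
  by (simp add: trilog_def trilog_series_def polylog_series_def)

lemma dilog_holomorphic: "dilog holomorphic_on slit_plane"
  unfolding dilog_def
  by (intro holomorphic_intros trilog_holomorphic open_slit_plane)

lemma trilog_has_deriv:
  assumes "z \<in> slit_plane"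
  shows "(trilog has_field_derivative deriv trilog z) (at z)"
  by (rule holomorphic_derivI[OF trilog_holomorphic open_slit_plane assms])

lemma trilog_has_deriv':
  assumes "z \<in> slit_plane" "z \<noteq> 0"
  shows "(trilog has_field_derivative dilog z / z) (at z)"
  using trilog_has_deriv[OF assms(1)] assms(2) by (simp add: dilog_def)

lemma dilog_eq_series_ball:
  assumes "norm z < 1"
  shows "dilog z = polylog_series 2 z"
proof -
  have "(trilog has_field_derivative (\<Sum>k. z ^ k / of_nat (Suc k) ^ 2)) (at z)"
  proof (rule has_field_derivative_transform_within_open[of "polylog_series 3" _ _ "ball 0 1"])
    show "(polylog_series 3 has_field_derivative (\<Sum>k. z ^ k / of_nat (Suc k) ^ 2)) (at z)"
      using polylog_series_deriv(1)[OF assms, of 2] by (simp add: numeral_3_eq_3 del: of_nat_Suc)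
  qed (use assms in \<open>auto simp: trilog_eq_series\<close>)
  hence "deriv trilog z = (\<Sum>k. z ^ k / of_nat (Suc k) ^ 2)" by (rule DERIV_imp_deriv)
  thus ?thesis unfolding dilog_def using polylog_series_deriv(2)[OF assms, of 2] by simp
qed

text \<open>Translates the branch condition for \<open>Ln (1 - z)\<close> into the domain of the
  polylogarithms.\<close>

lemma one_minus_slit_plane: "1 - z \<notin> \<real>\<^sub>\<le>\<^sub>0 \<longleftrightarrow> z \<in> slit_plane"
proof
  assume *: "1 - z \<notin> \<real>\<^sub>\<le>\<^sub>0"
  have "1 - complex_of_real x \<in> \<real>\<^sub>\<le>\<^sub>0" if "x \<ge> 1" for x
    using that by (metis (no_types) diff_le_0_iff_le nonpos_Reals_of_real_iff of_real_1 of_real_diff)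
  thus "z \<in> slit_plane" using * by auto
next
  assume *: "z \<in> slit_plane"
  show "1 - z \<notin> \<real>\<^sub>\<le>\<^sub>0"
  proof
    assume "1 - z \<in> \<real>\<^sub>\<le>\<^sub>0"
    then obtain r where "1 - z = of_real r" "r \<le> 0" by (auto elim!: nonpos_Reals_cases)
    hence "z = of_real (1 - r)" "1 - r \<ge> 1" by (auto simp: algebra_simps)
    thus False using * by blast
  qed
qed

lemma connected_slit_plane: "connected slit_plane"
  by (intro starlike_imp_connected starlike_slotted_complex_plane_right)

text \<open>Both sides are holomorphic on the slit plane and agree on the unit disc, where termwise
  differentiation gives the logarithm series; the identity theorem extends this. The factor
  \<open>z\<close> keeps the equation free of a quotient at 0.\<close>

lemma dilog_deriv_mult:
  assumes "z \<in> slit_plane"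
  shows "z * deriv dilog z = - Ln (1 - z)"
proof (rule analytic_continuation_open[of "ball 0 1" slit_plane "\<lambda>z. z * deriv dilog z" "\<lambda>z. - Ln (1 - z)"])
  show "(\<lambda>z. z * deriv dilog z) holomorphic_on slit_plane"
    by (intro holomorphic_intros dilog_holomorphic open_slit_plane)
  show "(\<lambda>z. - Ln (1 - z)) holomorphic_on slit_plane"
    by (intro holomorphic_intros) (simp add: one_minus_slit_plane)
  fix z :: complex assume "z \<in> ball 0 1"
  hence z: "norm z < 1" by simp
  have "(dilog has_field_derivative (\<Sum>k. z ^ k / of_nat (Suc k) ^ 1)) (at z)"
  proof (rule has_field_derivative_transform_within_open[of "polylog_series 2" _ _ "ball 0 1"])
    show "(polylog_series 2 has_field_derivative (\<Sum>k. z ^ k / of_nat (Suc k) ^ 1)) (at z)"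
      using polylog_series_deriv(1)[OF z, of 1] by (simp add: numeral_2_eq_2 del: of_nat_Suc)
  qed (use z in \<open>auto simp: dilog_eq_series_ball\<close>)
  hence "z * deriv dilog z = polylog_series 1 z"
    using polylog_series_deriv(2)[OF z, of 1] by (simp add: DERIV_imp_deriv)
  also have "(\<lambda>k. 1 / of_nat k ^ 1 * z ^ k) sums (- Ln (1 - z))"
    using sums_minus[OF Ln_series'[of "-z"]] z by simp
  hence "(\<lambda>k. 1 / of_nat (Suc k) ^ 1 * z ^ Suc k) sums (- Ln (1 - z))"
    by (subst sums_Suc_iff) simp
  hence "polylog_series 1 z = - Ln (1 - z)"
    unfolding polylog_series_def by (simp add: sums_iff del: of_nat_Suc)
  finally show "z * deriv dilog z = - Ln (1 - z)" .
qed (use assms ball_subset_slit_plane open_slit_plane connected_slit_plane in auto)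

lemma dilog_has_deriv:
  assumes "z \<in> slit_plane" "z \<noteq> 0"
  shows "(dilog has_field_derivative - Ln (1 - z) / z) (at z)"
  using holomorphic_derivI[OF dilog_holomorphic open_slit_plane assms(1)] dilog_deriv_mult[OF assms(1)]
    assms(2) by (metis nonzero_mult_div_cancel_left)

text \<open>On the unit circle the value is a radial limit from the open disc: \<open>dilog\<close>
  is continuous off the cut, and the series is continuous on the closed disc.\<close>

lemma dilog_eq_series:
  assumes z: "z \<in> slit_plane" and nz: "norm z \<le> 1"
  shows "dilog z = polylog_series 2 z"
proof -
  define w where "w = (\<lambda>n. of_real (1 - 1 / real (n + 2)) * z)"
  have nw: "norm (w n) < 1" for n
  proof -
    have "norm (w n) = (1 - 1 / real (n + 2)) * norm z"
      unfolding w_def norm_mult norm_of_real by simp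
    also have "\<dots> \<le> (1 - 1 / real (n + 2)) * 1"
      using nz by (intro mult_left_mono) auto
    also have "\<dots> < 1" by simp
    finally show ?thesis .
  qed
  have "w \<longlonglongrightarrow> of_real (1 - 0) * z"
    unfolding w_def
    by (intro tendsto_intros LIMSEQ_ignore_initial_segment[OF lim_1_over_n])
  hence w: "w \<longlonglongrightarrow> z" by simp
  have "isCont dilog z"
    using z open_slit_plane holomorphic_on_imp_continuous_on[OF dilog_holomorphic]
      continuous_on_eq_continuous_at by blast
  hence 1: "(\<lambda>n. dilog (w n)) \<longlonglongrightarrow> dilog z" using w by (rule isCont_tendsto_compose)
  have 2: "(\<lambda>n. polylog_series 2 (w n)) \<longlonglongrightarrow> polylog_series 2 z"
    by (rule continuous_on_tendsto_compose[OF polylog_series_continuous w])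
       (use nz nw in \<open>auto intro!: always_eventually less_imp_le\<close>)
  have "(\<lambda>n. dilog (w n)) = (\<lambda>n. polylog_series 2 (w n))"
    using nw by (auto simp: dilog_eq_series_ball)
  thus ?thesis using 1 2 LIMSEQ_unique by auto
qed

text \<open>The Basel sum. The point 1 lies on the cut, so this is a value of the series and not of
  \<open>dilog\<close>.\<close>

lemma polylog_series_2_1: "polylog_series 2 1 = of_real (pi\<^sup>2 / 6)"
proof -
  have "(\<lambda>k. complex_of_real (1 / (real k + 1)\<^sup>2)) sums of_real (pi\<^sup>2 / 6)"
    using inverse_squares_sums by (subst sums_of_real_iff) (simp add: add_ac)
  thus ?thesis unfolding polylog_series_def by (simp add: sums_iff add_ac)
qed

lemma polylog_series_0: "polylog_series p 0 = 0"
  by (simp add: polylog_series_def)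

subsection \<open>Primitives of the squared logarithm\<close>

abbreviation left_slit_plane :: "complex set" where
  "left_slit_plane \<equiv> - \<real>\<^sub>\<le>\<^sub>0"

lemma left_slit_plane_altdef: "left_slit_plane = - (complex_of_real ` {..0})"
  by (auto elim!: nonpos_Reals_cases)

lemma starlike_left_slit_plane: "starlike left_slit_plane"
  unfolding left_slit_plane_altdef by (rule starlike_slotted_complex_plane_left)

lemma open_left_slit_plane: "open left_slit_plane"
  by auto

lemma connected_left_slit_plane: "connected left_slit_plane"
  by (rule starlike_imp_connected[OF starlike_left_slit_plane])

text \<open>At \<open>z = 1\<close> the convention \<open>x / 0 = 0\<close> agrees with the removed singularity.\<close>

lemma ex_Ln_sq_primitive:
  "\<exists>P. P 1 = 0 \<and> (\<forall>z\<in>left_slit_plane. (P has_field_derivative Ln z ^ 2 / (z - 1)) (at z))"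
proof -
  define h where "h = (\<lambda>z. if z = 1 then deriv Ln 1 else (Ln z - Ln 1) / (z - 1))"
  have h: "h holomorphic_on left_slit_plane"
    unfolding h_def by (rule pole_lemma_open) (auto intro!: holomorphic_intros)
  have *: "Ln z ^ 2 / (z - 1) = Ln z * h z" for z
    by (simp add: h_def power2_eq_square)
  have hol: "(\<lambda>z. Ln z ^ 2 / (z - 1)) holomorphic_on left_slit_plane"
    unfolding * by (intro holomorphic_intros h) auto
  have "\<exists>P. \<forall>x\<in>left_slit_plane. (P has_field_derivative Ln x ^ 2 / (x - 1)) (at x)"
  proof (rule holomorphic_starlike_primitive[OF _ starlike_left_slit_plane open_left_slit_plane finite.emptyI])
    show "continuous_on left_slit_plane (\<lambda>z. Ln z ^ 2 / (z - 1))"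
      by (rule holomorphic_on_imp_continuous_on[OF hol])
    show "(\<lambda>z. Ln z ^ 2 / (z - 1)) field_differentiable at x" if "x \<in> left_slit_plane - {}" for x
      using hol open_left_slit_plane that by (auto intro: holomorphic_on_imp_differentiable_at)
  qed
  then obtain P where P: "\<And>x. x \<in> left_slit_plane \<Longrightarrow> (P has_field_derivative Ln x ^ 2 / (x - 1)) (at x)"
    by blast
  show ?thesis
    by (rule exI[of _ "\<lambda>z. P z - P 1"]) (auto intro!: derivative_eq_intros P)
qed

text \<open>On the left slit plane, which is connected, the derivative and the value at 1 determine
  the function, so \<open>SOME\<close> makes no arbitrary choice there. Only these values are
  meaningful.\<close>

definition Ln_sq_primitive :: "complex \<Rightarrow> complex" where
  "Ln_sq_primitive = (SOME P. P 1 = 0 \<and>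
     (\<forall>z\<in>left_slit_plane. (P has_field_derivative Ln z ^ 2 / (z - 1)) (at z)))"

lemma Ln_sq_primitive_1 [simp]: "Ln_sq_primitive 1 = 0"
  using someI_ex[OF ex_Ln_sq_primitive] by (simp add: Ln_sq_primitive_def)

lemma Ln_sq_primitive_deriv:
  assumes "z \<notin> \<real>\<^sub>\<le>\<^sub>0"
  shows "(Ln_sq_primitive has_field_derivative Ln z ^ 2 / (z - 1)) (at z)"
  using someI_ex[OF ex_Ln_sq_primitive] assms by (simp add: Ln_sq_primitive_def)

text \<open>The functional equations below are derived from this: the difference of the two sides
  has derivative zero, and one value or limit fixes the constant.\<close>

lemma deriv_zero_imp_constant:
  fixes f :: "complex \<Rightarrow> complex"
  assumes "open S" "connected S" "\<And>z. z \<in> S \<Longrightarrow> (f has_field_derivative 0) (at z)"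
    and "a \<in> S" "z \<in> S"
  shows "f z = f a"
proof -
  have "continuous_on S f"
    by (meson assms(3) DERIV_isCont continuous_at_imp_continuous_on)
  thus ?thesis
    using DERIV_zero_connected_constant[OF assms(2,1) finite.emptyI, of f] assms(3,4,5) by (metis DiffD1)
qed

lemma cnj_nonpos_Reals_iff: "cnj z \<in> \<real>\<^sub>\<le>\<^sub>0 \<longleftrightarrow> z \<in> \<real>\<^sub>\<le>\<^sub>0"
  by (simp add: complex_nonpos_Reals_iff)

text \<open>Schwarz reflection: \<open>cnj \<circ> Ln_sq_primitive \<circ> cnj\<close> has the same
  derivative and the same value at 1.\<close>

lemma Ln_sq_primitive_cnj:
  assumes "z \<notin> \<real>\<^sub>\<le>\<^sub>0"
  shows "Ln_sq_primitive (cnj z) = cnj (Ln_sq_primitive z)"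
proof -
  define f where "f = (\<lambda>z. (cnj \<circ> Ln_sq_primitive \<circ> cnj) z - Ln_sq_primitive z)"
  have "f z = f 1"
  proof (rule deriv_zero_imp_constant[of left_slit_plane f])
    fix z assume z: "z \<in> left_slit_plane"
    have "((cnj \<circ> Ln_sq_primitive \<circ> cnj) has_field_derivative cnj (Ln (cnj z) ^ 2 / (cnj z - 1))) (at z)"
      using z by (intro has_field_derivative_cnj_cnj Ln_sq_primitive_deriv) (simp add: cnj_nonpos_Reals_iff)
    moreover have "cnj (Ln (cnj z) ^ 2 / (cnj z - 1)) = Ln z ^ 2 / (z - 1)"
      using z by (simp add: cnj_Ln cnj_nonpos_Reals_iff)
    ultimately show "(f has_field_derivative 0) (at z)"
      unfolding f_def using DERIV_diff[OF _ Ln_sq_primitive_deriv[of z]] z by force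
  qed (use assms connected_left_slit_plane in auto)
  thus ?thesis by (simp add: f_def) (metis complex_cnj_cnj)
qed

lemma inverse_nonpos_Reals_iff: "inverse z \<in> \<real>\<^sub>\<le>\<^sub>0 \<longleftrightarrow> z \<in> \<real>\<^sub>\<le>\<^sub>0" for z :: complex
  by (metis inverse_inverse_eq nonpos_Reals_inverse_I)

text \<open>Substituting \<open>inverse z\<close> leaves the squared logarithm unchanged and turns
  the kernel \<open>1 / (z - 1)\<close> into \<open>1 / (z * (z - 1)) = 1 / (z - 1) - 1 / z\<close>;
  the last term integrates to the cube. This is the trilogarithm inversion in terms of the
  primitive.\<close>

lemma Ln_sq_primitive_inverse:
  assumes "z \<notin> \<real>\<^sub>\<le>\<^sub>0"
  shows "Ln_sq_primitive (inverse z) = Ln_sq_primitive z - Ln z ^ 3 / 3"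
proof -
  define f where "f = (\<lambda>z. Ln_sq_primitive (inverse z) - Ln_sq_primitive z + Ln z ^ 3 / 3)"
  have "f z = f 1"
  proof (rule deriv_zero_imp_constant[of left_slit_plane f])
    fix z assume z: "z \<in> left_slit_plane"
    hence z0: "z \<noteq> 0" by auto
    have inv: "((\<lambda>z. Ln_sq_primitive (inverse z)) has_field_derivative
            Ln (inverse z) ^ 2 / (inverse z - 1) * (- inverse (z ^ 2))) (at z)"
      using z z0 by (intro DERIV_chain2[OF Ln_sq_primitive_deriv])
        (auto simp: inverse_nonpos_Reals_iff power2_eq_square intro!: derivative_eq_intros)
    have cube: "((\<lambda>z. Ln z ^ 3 / 3) has_field_derivative Ln z ^ 2 / z) (at z)"
      using z z0 by (auto intro!: derivative_eq_intros simp: field_simps)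
    have "Ln (inverse z) ^ 2 / (inverse z - 1) * (- inverse (z ^ 2)) - Ln z ^ 2 / (z - 1) + Ln z ^ 2 / z = 0"
    proof (cases "z = 1")
      case False
      hence "1 - z \<noteq> 0" "z - 1 \<noteq> 0" by auto
      moreover have "Ln (inverse z) ^ 2 = Ln z ^ 2" using z by (simp add: Ln_inverse)
      moreover have "inverse z - 1 = (1 - z) / z" using z0 by (simp add: field_simps)
      ultimately show ?thesis using z0 
        by (simp add: divide_simps power2_eq_square) (simp add: algebra_simps)
    qed auto
    thus "(f has_field_derivative 0) (at z)"
      using DERIV_add[OF DERIV_diff[OF inv Ln_sq_primitive_deriv[of z]] cube] z
      unfolding f_def by auto
  qed (use assms connected_left_slit_plane in auto)
  thus ?thesis by (simp add: f_def algebra_simps)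
qed

section \<open>The same primitive in terms of polylogarithms, with a general pole\<close>

definition Ln_sq_polylog :: "complex \<Rightarrow> complex \<Rightarrow> complex" where
  "Ln_sq_polylog a z = Ln z ^ 2 * Ln (1 - z / a) + 2 * Ln z * dilog (z / a) - 2 * trilog (z / a)"

text \<open>Two integrations by parts lead to this expression. In the derivative the terms with
  \<open>Ln (1 - z / a)\<close> and with \<open>dilog (z / a)\<close> cancel in pairs, and only the
  derivative of \<open>Ln (1 - z / a)\<close> survives.\<close>

lemma Ln_sq_polylog_deriv:
  assumes "a \<noteq> 0" "z \<notin> \<real>\<^sub>\<le>\<^sub>0" "z / a \<in> slit_plane"
  shows "(Ln_sq_polylog a has_field_derivative Ln z ^ 2 / (z - a)) (at z)"
proof -
  have z0: "z \<noteq> 0" using assms(2) by auto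
  have za: "1 - z / a \<notin> \<real>\<^sub>\<le>\<^sub>0"
    using assms(3) by (simp only: one_minus_slit_plane not_False_eq_True)
  hence "z \<noteq> a" using assms(1) by auto
  have lin: "((\<lambda>z. z / a) has_field_derivative 1 / a) (at z)"
    using assms(1) by (auto intro!: derivative_eq_intros)
  have d: "((\<lambda>z. dilog (z / a)) has_field_derivative - Ln (1 - z / a) / z) (at z)"
    using DERIV_chain2[OF dilog_has_deriv[OF assms(3)] lin] assms z0 by simp
  have t: "((\<lambda>z. trilog (z / a)) has_field_derivative dilog (z / a) / z) (at z)"
    using DERIV_chain2[OF trilog_has_deriv'[OF assms(3)] lin] assms z0 by simp
  have "inverse (1 - z / a) * (0 - 1 / a) = 1 / (z - a)"
    using \<open>z \<noteq> a\<close> assms by (simp add: divide_simps)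
  hence l: "((\<lambda>z. Ln (1 - z / a)) has_field_derivative 1 / (z - a)) (at z)"
    using DERIV_chain2[OF has_field_derivative_Ln[OF za] DERIV_diff[OF DERIV_const lin]] by metis
  have L: "(Ln has_field_derivative inverse z) (at z)"
    by (rule has_field_derivative_Ln[OF assms(2)])
  show ?thesis
    unfolding Ln_sq_polylog_def[abs_def] power2_eq_square
    by (rule DERIV_cong[OF DERIV_diff[OF DERIV_add[OF DERIV_mult[OF DERIV_mult[OF L L] l]
          DERIV_mult[OF DERIV_cmult[OF L, of 2] d]] DERIV_cmult[OF t, of 2]]])
       (simp add: divide_inverse algebra_simps)
qed

text \<open>The set consists of the nonreal numbers and the real interval from 0 to 1 without end
  points, hence is starlike about \<open>1 / 2\<close>.\<close>

lemma connected_twice_slit_plane: "connected (slit_plane \<inter> left_slit_plane)"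
proof (rule starlike_imp_connected, unfold starlike_def, intro bexI[of _ "1/2"] ballI subsetI)
  show half: "1 / 2 \<in> slit_plane \<inter> left_slit_plane"
    by (auto simp: complex_nonpos_Reals_iff complex_eq_iff)
  fix x w assume x: "x \<in> slit_plane \<inter> left_slit_plane" and "w \<in> closed_segment (1 / 2) x"
  then obtain u where u: "0 \<le> u" "u \<le> 1" "w = (1 - u) *\<^sub>R (1 / 2) + u *\<^sub>R x"
    by (auto simp: closed_segment_def)
  have *: "z \<in> slit_plane \<inter> left_slit_plane \<longleftrightarrow> (Im z = 0 \<longrightarrow> 0 < Re z \<and> Re z < 1)" for z
    by (auto simp: complex_nonpos_Reals_iff complex_eq_iff image_iff not_le not_less)
  show "w \<in> slit_plane \<inter> left_slit_plane"
  proof (cases "u = 0")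
    case True
    hence "w = 1 / 2" using u by (simp add: scaleR_conv_of_real)
    thus ?thesis using half by metis
  next
    case False
    have "0 < Re w \<and> Re w < 1" if "Im w = 0"
    proof -
      \<comment> \<open>As \<open>1 / 2\<close> is real and \<open>u \<noteq> 0\<close>, a real
        \<open>w\<close> forces \<open>x\<close> to be real.\<close>
      have "0 < Re x" "Re x < 1" using that x False u unfolding * by auto
      hence "0 < u * Re x" "u * Re x < u" using u False by auto
      moreover have "Re w = (1 - u) / 2 + u * Re x" using u by simp
      moreover have "(1 - u) / 2 \<ge> 0" "(1 - u) / 2 + u \<le> 1" using u by (auto simp: field_simps)
      ultimately show ?thesis by linarith
    qed
    thus ?thesis unfolding * by blast
  qed
qed

lemma Ln_sq_polylog_1_eq_primitive:
  obtains c where "\<And>z. z \<in> slit_plane \<Longrightarrow> z \<notin> \<real>\<^sub>\<le>\<^sub>0 \<Longrightarrow>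
    Ln_sq_polylog 1 z = Ln_sq_primitive z + complex_of_real c"
proof -
  define f where "f = (\<lambda>z. Ln_sq_polylog 1 z - Ln_sq_primitive z)"
  \<comment> \<open>The constant is only needed to be real, so no limit at the boundary point 1 is taken.\<close>
  have "f z = f (1 / 2)" if "z \<in> slit_plane \<inter> left_slit_plane" for z
  proof (rule deriv_zero_imp_constant[OF _ connected_twice_slit_plane, of f])
    show "(f has_field_derivative 0) (at z)" if "z \<in> slit_plane \<inter> left_slit_plane" for z
      unfolding f_def
      using DERIV_diff[OF Ln_sq_polylog_deriv[of 1 z] Ln_sq_primitive_deriv[of z]] that by simp
  qed (use that open_slit_plane in \<open>auto simp: complex_nonpos_Reals_iff complex_eq_iff intro!: open_Int\<close>)
  \<comment> \<open>At the real point \<open>1 / 2\<close> every ingredient of \<open>f\<close> is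
    fixed by conjugation.\<close>
  moreover have "f (1 / 2) \<in> \<real>"
  proof -
    have "cnj (Ln_sq_primitive (1 / 2)) = Ln_sq_primitive (1 / 2)"
      by (subst Ln_sq_primitive_cnj[symmetric]) (auto simp: complex_nonpos_Reals_iff)
    moreover have "cnj (polylog_series p (1 / 2)) = polylog_series p (1 / 2)" if "p \<ge> 2" for p
      by (subst polylog_series_cnj[symmetric]) (use that in auto)
    moreover have "cnj (Ln (1 / 2)) = Ln (1 / 2)"
      by (subst cnj_Ln) (auto simp: complex_nonpos_Reals_iff)
    ultimately have "cnj (f (1 / 2)) = f (1 / 2)"
      unfolding f_def Ln_sq_polylog_def by (simp add: trilog_eq_series dilog_eq_series_ball)
    thus ?thesis by (simp add: complex_is_Real_iff complex_eq_iff)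
  qed
  then obtain c where "f (1 / 2) = complex_of_real c" by (auto elim: Reals_cases)
  ultimately show ?thesis using that[of c] by (force simp: f_def algebra_simps)
qed

text \<open>Since the argument is bounded by \<open>pi\<close>, the modulus of \<open>Ln z\<close>
  is at most \<open>\<bar>ln (norm z)\<bar> + pi\<close>, which reduces both limits to real ones at
  0 from the right.\<close>

lemma tendsto_Ln_sq_times_self:
  assumes "(f \<longlongrightarrow> 0) F" "\<forall>\<^sub>F x in F. f x \<noteq> 0"
  shows "((\<lambda>x. Ln (f x) ^ 2 * f x) \<longlongrightarrow> 0) F" and "((\<lambda>x. Ln (f x) * f x) \<longlongrightarrow> 0) F"
proof -
  have lim: "filterlim (\<lambda>x. norm (f x)) (at_right 0) F"
    using tendsto_norm_zero[OF assms(1)] assms(2)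
    by (auto simp: filterlim_at elim!: eventually_mono)
  have bound: "norm (Ln z) \<le> \<bar>ln (norm z)\<bar> + pi" if "z \<noteq> 0" for z
  proof -
    have "\<bar>Im (Ln z)\<bar> \<le> pi" using Im_Ln_le_pi[OF that] mpi_less_Im_Ln[OF that] by simp
    thus ?thesis using cmod_le[of "Ln z"] that by simp
  qed
  have r2: "((\<lambda>r::real. (\<bar>ln r\<bar> + pi) ^ 2 * r) \<longlongrightarrow> 0) (at_right 0)" by real_asymp
  have r1: "((\<lambda>r::real. (\<bar>ln r\<bar> + pi) * r) \<longlongrightarrow> 0) (at_right 0)" by real_asymp
  show "((\<lambda>x. Ln (f x) ^ 2 * f x) \<longlongrightarrow> 0) F"
    by (rule Lim_null_comparison[OF _ filterlim_compose[OF r2 lim]])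
       (use assms(2) bound in \<open>auto elim!: eventually_mono simp: norm_mult norm_power intro!: mult_right_mono power_mono\<close>)
  show "((\<lambda>x. Ln (f x) * f x) \<longlongrightarrow> 0) F"
    by (rule Lim_null_comparison[OF _ filterlim_compose[OF r1 lim]])
       (use assms(2) bound in \<open>auto elim!: eventually_mono simp: norm_mult intro!: mult_right_mono\<close>)
qed

text \<open>A difference quotient along \<open>f\<close>. It trades a function vanishing at 0 for a
  factor \<open>f x\<close>, which can then absorb a power of the logarithm.\<close>

lemma tendsto_divide_self:
  fixes g :: "complex \<Rightarrow> complex"
  assumes "(g has_field_derivative d) (at 0)" "g 0 = 0"
    and "(f \<longlongrightarrow> 0) F" "\<forall>\<^sub>F x in F. f x \<noteq> 0"
  shows "((\<lambda>x. g (f x) / f x) \<longlongrightarrow> d) F"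
proof -
  have "((\<lambda>h. g h / h) \<longlongrightarrow> d) (at 0)" using assms(1,2) by (simp add: DERIV_def)
  moreover have "filterlim f (at 0) F" using assms(3,4) by (simp add: filterlim_at)
  ultimately show ?thesis by (rule filterlim_compose)
qed

lemma dilog_0 [simp]: "dilog 0 = 0"
  by (simp add: dilog_def)

lemma trilog_0 [simp]: "trilog 0 = 0"
  by (simp add: trilog_eq_series polylog_series_0)

lemma Ln_one_minus_has_deriv_0: "a \<noteq> 0 \<Longrightarrow> ((\<lambda>z. Ln (1 - z / a)) has_field_derivative - 1 / a) (at 0)"
  by (auto intro!: derivative_eq_intros simp: complex_nonpos_Reals_iff)

text \<open>Each power of \<open>Ln\<close> is multiplied by a function that vanishes to first order
  at 0. This gives the boundary value at the branch point, where the primitive itself has no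
  derivative to appeal to.\<close>

lemma Ln_sq_polylog_tendsto_0:
  assumes lim: "(f \<longlongrightarrow> 0) F" "\<forall>\<^sub>F x in F. f x \<noteq> 0" and "a \<noteq> 0"
  shows "((\<lambda>x. Ln_sq_polylog a (f x)) \<longlongrightarrow> 0) F"
proof -
  have lin: "((\<lambda>z. z / a) has_field_derivative 1 / a) (at 0)"
    using assms by (auto intro!: derivative_eq_intros)
  have "(dilog has_field_derivative deriv dilog (0 / a)) (at (0 / a))"
    using zero_in_slit_plane by (auto intro!: holomorphic_derivI[OF dilog_holomorphic open_slit_plane])
  hence d: "((\<lambda>z. dilog (z / a)) has_field_derivative deriv dilog (0 / a) * (1 / a)) (at 0)"
    by (rule DERIV_chain2[OF _ lin])
  have "isCont trilog 0"
    using trilog_has_deriv[OF zero_in_slit_plane] by (rule DERIV_isCont)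
  moreover have "((\<lambda>x. f x / a) \<longlongrightarrow> 0) F" using tendsto_divide[OF lim(1) tendsto_const \<open>a \<noteq> 0\<close>] by simp
  ultimately have t: "((\<lambda>x. trilog (f x / a)) \<longlongrightarrow> trilog 0) F" by (rule isCont_tendsto_compose)
  have "((\<lambda>x. Ln (f x) ^ 2 * f x * (Ln (1 - f x / a) / f x)
           + 2 * (Ln (f x) * f x * (dilog (f x / a) / f x)) - 2 * trilog (f x / a))
        \<longlongrightarrow> 0 * (- 1 / a) + 2 * (0 * (deriv dilog (0 / a) * (1 / a))) - 2 * trilog 0) F"
    by (intro tendsto_intros t tendsto_Ln_sq_times_self lim
          tendsto_divide_self[OF Ln_one_minus_has_deriv_0] tendsto_divide_self[OF d]) (use assms in auto)
  hence "((\<lambda>x. Ln (f x) ^ 2 * f x * (Ln (1 - f x / a) / f x)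
           + 2 * (Ln (f x) * f x * (dilog (f x / a) / f x)) - 2 * trilog (f x / a)) \<longlongrightarrow> 0) F"
    by simp
  thus ?thesis
    by (rule Lim_transform_eventually)
       (use lim(2) in \<open>auto elim!: eventually_mono simp: Ln_sq_polylog_def\<close>)
qed

text \<open>By differentiation the left side is constant. Its value is the limit at 0 along the
  positive reals, where the product of logarithms vanishes and \<open>dilog (1 - z)\<close> tends to
  the Basel sum.\<close>

lemma dilog_reflection:
  assumes "z \<in> slit_plane" "z \<notin> \<real>\<^sub>\<le>\<^sub>0"
  shows "dilog z + dilog (1 - z) + Ln z * Ln (1 - z) = of_real (pi\<^sup>2 / 6)"
proof -
  define f where "f = (\<lambda>z. dilog z + dilog (1 - z) + Ln z * Ln (1 - z))"
  have const: "f w = f z" if "w \<in> slit_plane \<inter> left_slit_plane" for w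
  proof (rule deriv_zero_imp_constant[OF _ connected_twice_slit_plane, of f])
    fix z assume "z \<in> slit_plane \<inter> left_slit_plane"
    hence z: "z \<in> slit_plane" "z \<notin> \<real>\<^sub>\<le>\<^sub>0" by auto
    have z': "1 - z \<notin> \<real>\<^sub>\<le>\<^sub>0" "1 - z \<in> slit_plane"
      using z one_minus_slit_plane[of z] one_minus_slit_plane[of "1 - z"] by simp_all
    have nz: "z \<noteq> 0" "1 - z \<noteq> 0" using z z' by auto
    have d: "((\<lambda>z. dilog (1 - z)) has_field_derivative - Ln (1 - (1 - z)) / (1 - z) * (0 - 1)) (at z)"
      using z' nz by (intro DERIV_chain2[OF dilog_has_deriv] DERIV_diff DERIV_ident) auto
    show "(f has_field_derivative 0) (at z)"
      unfolding f_def using z z' nz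
      by (auto intro!: derivative_eq_intros dilog_has_deriv d simp: divide_inverse mult.commute)
  qed (use that assms open_slit_plane in \<open>auto intro!: open_Int\<close>)
  \<comment> \<open>The shift by 2 keeps every point strictly between 0 and 1, off both
    cuts.\<close>
  define x where "x = (\<lambda>n. complex_of_real (1 / real (n + 2)))"
  have x: "x n \<in> slit_plane \<inter> left_slit_plane" "x n \<noteq> 0" "norm (1 - x n) < 1" for n
  proof -
    have "1 - x n = of_real (1 - 1 / real (n + 2))" by (simp add: x_def)
    hence "norm (1 - x n) = 1 - 1 / real (n + 2)" by (simp only: norm_of_real) simp
    thus "norm (1 - x n) < 1" by simp
    have *: "of_real r \<in> slit_plane \<inter> left_slit_plane" "complex_of_real r \<noteq> 0" if "0 < r" "r < 1" for r
      using that by (auto simp: complex_nonpos_Reals_iff)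
    show "x n \<in> slit_plane \<inter> left_slit_plane" "x n \<noteq> 0"
      unfolding x_def by (rule *; simp)+
  qed
  have "(\<lambda>n. 1 / real (n + 2)) \<longlonglongrightarrow> 0" by (rule LIMSEQ_ignore_initial_segment[OF lim_1_over_n])
  hence "x \<longlonglongrightarrow> of_real 0" unfolding x_def by (rule tendsto_of_real)
  hence lim: "x \<longlonglongrightarrow> 0" by simp
  have nz: "\<forall>\<^sub>F n in sequentially. x n \<noteq> 0" using x by auto
  have 1: "(\<lambda>n. dilog (x n)) \<longlonglongrightarrow> dilog 0"
  proof (rule isCont_tendsto_compose[OF _ lim])
    show "isCont dilog 0"
      using holomorphic_derivI[OF dilog_holomorphic open_slit_plane zero_in_slit_plane] by (rule DERIV_isCont)
  qed
  \<comment> \<open>The limit point 1 is on the cut of \<open>dilog\<close>, so continuity is taken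
    from the series on the closed disc.\<close>
  have "(\<lambda>n. polylog_series 2 (1 - x n)) \<longlonglongrightarrow> polylog_series 2 1"
    by (rule continuous_on_tendsto_compose[OF polylog_series_continuous])
       (use x(3) tendsto_diff[OF tendsto_const lim, of 1] in \<open>auto intro!: always_eventually less_imp_le\<close>)
  hence 2: "(\<lambda>n. dilog (1 - x n)) \<longlonglongrightarrow> of_real (pi\<^sup>2 / 6)"
    using x(3) by (simp add: dilog_eq_series_ball polylog_series_2_1)
  have "(\<lambda>n. Ln (x n) * x n * (Ln (1 - x n / 1) / x n)) \<longlonglongrightarrow> 0 * (- 1 / 1)"
    by (intro tendsto_intros tendsto_Ln_sq_times_self lim nz
        tendsto_divide_self[OF Ln_one_minus_has_deriv_0]) auto
  hence 3: "(\<lambda>n. Ln (x n) * Ln (1 - x n)) \<longlonglongrightarrow> 0" using x(2) by simp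
  have "(\<lambda>n. f (x n)) \<longlonglongrightarrow> dilog 0 + of_real (pi\<^sup>2 / 6) + 0"
    unfolding f_def by (intro tendsto_add 1 2 3)
  moreover have "(\<lambda>n. f (x n)) = (\<lambda>n. f z)" using const x(1) by blast
  ultimately have "f z = of_real (pi\<^sup>2 / 6)" by (simp add: LIMSEQ_const_iff)
  thus ?thesis by (simp add: f_def)
qed

subsection \<open>Special values\<close>

text \<open>Separating odd from even exponents isolates what cancels between \<open>z\<close> and
  \<open>- z\<close>, and at \<open>\<i>\<close> it separates imaginary from real terms.\<close>

lemma polylog_series_grouped:
  assumes "p \<ge> 2" "norm z \<le> 1"
  shows "(\<lambda>n. z ^ (2 * n + 1) / of_nat (2 * n + 1) ^ p + z ^ (2 * n + 2) / of_nat (2 * n + 2) ^ p)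
           sums polylog_series p z"
proof -
  have "sum f {n * 2..<n * 2 + 2} = f (2 * n) + f (2 * n + 1)" for n and f :: "nat \<Rightarrow> complex"
    by (simp add: numeral_2_eq_2 mult.commute)
  thus ?thesis
    using sums_group[OF polylog_series_sums[OF assms], of 2] by (simp add: add_ac mult.commute del: of_nat_Suc power_Suc)
qed

text \<open>Odd exponents cancel, even ones double, and the even denominators release the factor
  \<open>2 ^ p\<close>.\<close>

lemma polylog_series_duplication:
  assumes "p \<ge> 2" "norm z \<le> 1"
  shows "polylog_series p z + polylog_series p (- z) = 2 / 2 ^ p * polylog_series p (z ^ 2)"
proof -
  have "norm (- z) \<le> 1" "norm (z ^ 2) \<le> 1"
    using assms(2) by (auto simp: norm_power power_le_one)
  note 1 = sums_add[OF polylog_series_grouped[OF assms] polylog_series_grouped[OF assms(1) this(1)]]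
  note 2 = sums_mult[OF polylog_series_sums[OF assms(1) \<open>norm (z ^ 2) \<le> 1\<close>], of "2 / 2 ^ p"]
  have "z ^ (2 * n + 1) / of_nat (2 * n + 1) ^ p + z ^ (2 * n + 2) / of_nat (2 * n + 2) ^ p
      + ((- z) ^ (2 * n + 1) / of_nat (2 * n + 1) ^ p + (- z) ^ (2 * n + 2) / of_nat (2 * n + 2) ^ p)
      = 2 / 2 ^ p * ((z ^ 2) ^ Suc n / of_nat (Suc n) ^ p)" for n
  proof -
    have "of_nat (2 * n + 2) = (2 * of_nat (Suc n) :: complex)" by simp
    moreover have "z ^ (2 * n + 2) = (z ^ 2) ^ Suc n" "(- z) ^ (2 * n + 2) = (z ^ 2) ^ Suc n"
      by (simp_all add: power_mult power_add power2_eq_square)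
    moreover have "(- z) ^ (2 * n + 1) = - (z ^ (2 * n + 1))" by simp
    ultimately show ?thesis
      by (simp add: power_mult_distrib del: of_nat_Suc power_Suc of_nat_add of_nat_mult)
  qed
  thus ?thesis using sums_unique2[OF 1] 2 by simp
qed

lemma Ln_1_plus_ii: "Ln (1 + \<i>) = Complex (ln 2 / 2) (pi / 4)"
proof (rule Ln_unique)
  have "exp (ln 2 / 2) = sqrt (2::real)" by (simp flip: ln_sqrt)
  thus "exp (Complex (ln 2 / 2) (pi / 4)) = 1 + \<i>"
    by (simp add: complex_eq_iff Re_exp Im_exp cos_45 sin_45)
qed auto

lemma ii_slit_plane: "\<i> \<in> slit_plane" "- \<i> \<in> slit_plane" "\<i> \<notin> \<real>\<^sub>\<le>\<^sub>0" "- \<i> \<notin> \<real>\<^sub>\<le>\<^sub>0"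
  by (auto simp: complex_eq_iff complex_nonpos_Reals_iff)

text \<open>Duplication leads from 1 to \<open>- 1\<close> and then to \<open>\<i>\<close>, where
  the two summands are conjugate; this gives the real part. The odd terms at \<open>\<i>\<close> are
  Catalan's series.\<close>

lemma dilog_ii: "dilog \<i> = Complex (- pi\<^sup>2 / 48) catalan"
proof -
  have d1: "polylog_series 2 1 + polylog_series 2 (- 1) = 1 / 2 * polylog_series 2 1"
    using polylog_series_duplication[of 2 1] by simp
  have "polylog_series 2 \<i> + polylog_series 2 (- \<i>) = 1 / 2 * polylog_series 2 (- 1)"
    using polylog_series_duplication[of 2 \<i>] by simp
  moreover have "polylog_series 2 (- \<i>) = cnj (polylog_series 2 \<i>)"
    using polylog_series_cnj[of 2 \<i>] by simp
  ultimately have "2 * Re (polylog_series 2 \<i>) = Re (polylog_series 2 (- 1)) / 2"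
    by (simp add: complex_eq_iff)
  moreover have "Re (polylog_series 2 (- 1)) = - pi\<^sup>2 / 12"
  proof -
    have "Re (polylog_series 2 1) + Re (polylog_series 2 (- 1)) = Re (1 / 2 * polylog_series 2 1)"
      using d1 by (metis plus_complex.sel(1))
    thus ?thesis by (simp add: polylog_series_2_1)
  qed
  ultimately have re: "Re (dilog \<i>) = - pi\<^sup>2 / 48"
    by (simp add: dilog_eq_series[OF ii_slit_plane(1)] dilog_eq_series[OF ii_slit_plane(2)])
  have "Im (\<i> ^ (2 * n + 1) / of_nat (2 * n + 1) ^ 2 + \<i> ^ (2 * n + 2) / of_nat (2 * n + 2) ^ 2)
      = (- 1) ^ n / (2 * real n + 1) ^ 2" for n
  proof -
    have "\<i> ^ (2 * n + 1) / of_nat (2 * n + 1) ^ 2 = of_real ((- 1) ^ n / (2 * real n + 1) ^ 2) * \<i>"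
      by (simp add: power_mult add_ac mult.commute[of \<i>])
    moreover have "\<i> ^ (2 * n + 2) / of_nat (2 * n + 2) ^ 2 = of_real (- ((- 1) ^ n) / (2 * real n + 2) ^ 2)"
      by (simp add: power_mult add_ac)
    ultimately show ?thesis by (simp only: plus_complex.sel Im_complex_of_real) simp
  qed
  hence "(\<lambda>n. (- 1) ^ n / (2 * real n + 1) ^ 2) sums Im (polylog_series 2 \<i>)"
    using sums_Im[OF polylog_series_grouped[of 2 \<i>]] by (simp add: add_ac)
  hence "Im (dilog \<i>) = catalan"
    by (simp add: dilog_eq_series[OF ii_slit_plane(1)] catalan_def sums_iff)
  thus ?thesis using re by (simp add: complex_eq_iff)
qed

lemma dilog_minus_ii: "dilog (- \<i>) = Complex (- pi\<^sup>2 / 48) (- catalan)"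
proof -
  have "dilog (- \<i>) = cnj (dilog \<i>)"
    using polylog_series_cnj[of 2 \<i>] by (simp add: dilog_eq_series[OF ii_slit_plane(1)] dilog_eq_series[OF ii_slit_plane(2)])
  thus ?thesis by (simp add: dilog_ii complex_eq_iff)
qed

text \<open>The point lies outside the unit disc, so reflection is applied at \<open>- \<i>\<close>,
  whose value comes from the series.\<close>

lemma dilog_1_plus_ii: "dilog (1 + \<i>) = Complex (pi\<^sup>2 / 16) (catalan + pi * ln 2 / 4)"
proof -
  have "dilog (1 + \<i>) = of_real (pi\<^sup>2 / 6) - Ln (- \<i>) * Ln (1 + \<i>) - dilog (- \<i>)"
    using dilog_reflection[OF ii_slit_plane(2,4)] by (simp del: of_real_divide add: algebra_simps)
  thus ?thesis
    by (simp add: Ln_1_plus_ii dilog_minus_ii complex_eq_iff) (simp add: field_simps power2_eq_square)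
qed

text \<open>The real constant between the two primitives disappears, so imaginary parts can be moved
  freely between them.\<close>

lemma Im_Ln_sq_polylog_1:
  assumes "z \<in> slit_plane" "z \<notin> \<real>\<^sub>\<le>\<^sub>0"
  shows "Im (Ln_sq_polylog 1 z) = Im (Ln_sq_primitive z)"
  using Ln_sq_polylog_1_eq_primitive assms by (metis Im_complex_of_real add.right_neutral plus_complex.sel(2))

text \<open>Inverse and conjugate of \<open>\<i>\<close> coincide, so inversion and conjugation
  together determine the imaginary part of the primitive at \<open>\<i>\<close>, and with it that of
  the trilogarithm.\<close>

lemma Im_trilog_minus_ii: "Im (trilog (- \<i>)) = - (pi ^ 3 / 32)"
proof -
  have "cnj (Ln_sq_primitive \<i>) = Ln_sq_primitive \<i> - Ln \<i> ^ 3 / 3"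
    using Ln_sq_primitive_inverse[of \<i>] Ln_sq_primitive_cnj[of \<i>] ii_slit_plane by simp
  hence "- Im (Ln_sq_primitive \<i>) = Im (Ln_sq_primitive \<i>) - Im (Ln \<i> ^ 3 / 3)"
    by (metis cnj.sel(2) minus_complex.sel(2))
  hence P: "Im (Ln_sq_primitive \<i>) = - (pi ^ 3 / 48)"
    by (simp add: power3_eq_cube)
  have "Ln (1 - \<i>) = cnj (Ln (1 + \<i>))"
    using cnj_Ln[of "1 + \<i>"] by (simp add: complex_nonpos_Reals_iff)
  hence "Ln (1 - \<i>) = Complex (ln 2 / 2) (- pi / 4)"
    by (simp add: Ln_1_plus_ii complex_eq_iff)
  hence "Im (Ln_sq_polylog 1 \<i>) = pi ^ 3 / 16 - pi ^ 3 / 48 - 2 * Im (trilog \<i>)"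
    by (simp add: Ln_sq_polylog_def dilog_ii power2_eq_square power3_eq_cube field_simps)
  hence *: "Im (trilog \<i>) = pi ^ 3 / 32"
    using P Im_Ln_sq_polylog_1[of \<i>] ii_slit_plane by simp
  have "trilog (- \<i>) = cnj (trilog \<i>)"
    using polylog_series_cnj[of 3 \<i>] by (simp add: trilog_eq_series)
  thus ?thesis using * by simp
qed

text \<open>Here the trilogarithm of the final formula enters. The other end point contributions
  reduce to this primitive and to multiples of \<open>pi ^ 3\<close>.\<close>

lemma Im_Ln_sq_primitive_1_plus_ii:
  "Im (Ln_sq_primitive (1 + \<i>)) = pi * (ln 2)\<^sup>2 / 8 + pi ^ 3 / 16 + catalan * ln 2 - 2 * Im (trilog (1 + \<i>))"
proof -
  have "Im (Ln_sq_primitive (1 + \<i>)) = Im (Ln_sq_polylog 1 (1 + \<i>))"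
    by (subst Im_Ln_sq_polylog_1) (auto simp: complex_eq_iff complex_nonpos_Reals_iff)
  also have "\<dots> = pi * (ln 2)\<^sup>2 / 8 + pi ^ 3 / 16 + catalan * ln 2 - 2 * Im (trilog (1 + \<i>))"
    by (simp add: Ln_sq_polylog_def dilog_1_plus_ii Ln_1_plus_ii power2_eq_square)
       (simp add: power3_eq_cube field_simps)
  finally show ?thesis .
qed

text \<open>For \<open>p = (1 + \<i>) / 2\<close> all symmetries meet: \<open>1 - p\<close> and
  \<open>p / \<i>\<close> both equal \<open>cnj p\<close>, and \<open>p\<close> is the inverse of
  \<open>cnj (1 + \<i>)\<close>. Hence both primitives at \<open>p\<close> involve only
  \<open>dilog p\<close>, \<open>trilog p\<close> and their conjugates, and inversion leads back to
  \<open>1 + \<i>\<close>.\<close>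

lemma Im_Ln_sq_polylog_ii_half:
  "Im (Ln_sq_polylog \<i> ((1 + \<i>) / 2)) - Im (Ln_sq_primitive ((1 + \<i>) / 2)) =
     2 * Im (Ln_sq_primitive (1 + \<i>)) + pi ^ 3 / 16"
proof -
  define p where "p = (1 + \<i>) / 2"
  have p: "p \<in> slit_plane" "p \<notin> \<real>\<^sub>\<le>\<^sub>0" "norm p < 1"
    by (auto simp: p_def complex_eq_iff complex_nonpos_Reals_iff cmod_def power2_eq_square real_less_lsqrt)
  have 1: "p = inverse (cnj (1 + \<i>))"
    by (simp add: p_def complex_eq_iff Re_divide Im_divide power2_eq_square)
  have u: "1 + \<i> \<notin> \<real>\<^sub>\<le>\<^sub>0" "cnj (1 + \<i>) \<notin> \<real>\<^sub>\<le>\<^sub>0" by (auto simp: complex_nonpos_Reals_iff)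
  have lc: "Ln (cnj (1 + \<i>)) = Complex (ln 2 / 2) (- pi / 4)"
    using cnj_Ln[OF u(1)] by (simp add: Ln_1_plus_ii complex_eq_iff)
  have lp: "Ln p = Complex (- ln 2 / 2) (pi / 4)"
    unfolding 1 using Ln_inverse[OF u(2)] lc by (simp add: complex_eq_iff)
  have lcp: "Ln (cnj p) = Complex (- ln 2 / 2) (- pi / 4)"
    using cnj_Ln[OF p(2)] by (simp add: lp complex_eq_iff)
  have pcp: "1 - p = cnj p" "1 - cnj p = p" "p / \<i> = cnj p"
    by (simp_all add: p_def complex_eq_iff Re_divide Im_divide power2_eq_square)
  have dc: "dilog (cnj p) = cnj (dilog p)" "trilog (cnj p) = cnj (trilog p)"
    using p polylog_series_cnj[of 2 p] polylog_series_cnj[of 3 p]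
    by (simp_all add: dilog_eq_series_ball trilog_eq_series)
  \<comment> \<open>Reflection between conjugate points yields only the real part of
    \<open>dilog p\<close>.\<close>
  have "dilog p + cnj (dilog p) + Ln p * Ln (cnj p) = of_real (pi\<^sup>2 / 6)"
    using dilog_reflection[OF p(1,2)] by (simp add: pcp dc)
  hence red: "Re (dilog p) = pi\<^sup>2 / 12 - (ln 2)\<^sup>2 / 8 - pi\<^sup>2 / 32"
    by (simp add: lp lcp complex_eq_iff power2_eq_square)
  have "Ln_sq_primitive p = cnj (Ln_sq_primitive (1 + \<i>)) - Ln (cnj (1 + \<i>)) ^ 3 / 3"
    unfolding 1 using Ln_sq_primitive_inverse[OF u(2)] Ln_sq_primitive_cnj[OF u(1)] by simp
  hence ip: "Im (Ln_sq_primitive p) = - Im (Ln_sq_primitive (1 + \<i>)) + pi * (ln 2)\<^sup>2 / 16 - pi ^ 3 / 192"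
    unfolding lc by (simp add: power3_eq_cube) (simp add: power2_eq_square power3_eq_cube field_simps)
  have "Im (Ln_sq_primitive p) = Im (Ln_sq_polylog 1 p)"
    by (subst Im_Ln_sq_polylog_1) (use p in auto)
  also have "\<dots> = pi * (ln 2)\<^sup>2 / 16 + pi ^ 3 / 64 - ln 2 * Im (dilog p) + pi * Re (dilog p) / 2
      - 2 * Im (trilog p)"
    by (simp add: Ln_sq_polylog_def pcp dc lp lcp power2_eq_square)
       (simp add: power2_eq_square power3_eq_cube field_simps)
  finally have P: "2 * Im (trilog p) = pi * (ln 2)\<^sup>2 / 16 + pi ^ 3 / 64 - ln 2 * Im (dilog p)
      + pi * Re (dilog p) / 2 - Im (Ln_sq_primitive p)"
    by simp
  \<comment> \<open>Replacing \<open>Im (trilog p)\<close> through \<open>P\<close> makes the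
    unknown \<open>Im (dilog p)\<close> cancel.\<close>
  have "Im (Ln_sq_polylog \<i> p) = Im (Ln_sq_primitive p)
      + pi * ((ln 2)\<^sup>2 / 4 - pi\<^sup>2 / 16) / 2 + 2 * (ln 2 * Im (dilog p)) + 2 * (2 * Im (trilog p))"
    using P unfolding Ln_sq_polylog_def pcp dc lp lcp
    by (simp add: power2_eq_square)
       (simp add: power2_eq_square power3_eq_cube field_simps)
  also have "\<dots> = Im (Ln_sq_primitive p) + 2 * Im (Ln_sq_primitive (1 + \<i>)) + pi ^ 3 / 16"
    unfolding P red ip by (simp add: power2_eq_square power3_eq_cube field_simps)
  finally show ?thesis by (simp add: p_def)
qed

subsection \<open>The dilogarithm integral\<close>

lemma Ln_1_plus_ii_times: "Ln (1 + \<i> * complex_of_real x) = Complex (ln (1 + x\<^sup>2) / 2) (arctan x)"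
proof (rule Ln_unique)
  have "exp (ln (1 + x\<^sup>2) / 2) = sqrt (1 + x\<^sup>2)"
    using sum_power2_gt_zero_iff[of 1 x] by (simp flip: ln_sqrt add: add_pos_nonneg)
  thus "exp (Complex (ln (1 + x\<^sup>2) / 2) (arctan x)) = 1 + \<i> * complex_of_real x"
    using sum_power2_gt_zero_iff[of 1 x]
    by (simp add: complex_eq_iff Re_exp Im_exp cos_arctan sin_arctan)
qed (use arctan_bounded[of x] pi_gt_zero in auto)

text \<open>Intended for Moebius maps \<open>g\<close> taking 0 to 1 and infinity to
  \<open>\<i>\<close>: then \<open>(g z - 1) / (g z - \<i>)\<close> is a constant multiple of
  \<open>z\<close>, and its logarithmic derivative is the condition on \<open>d\<close>. The
  positive real part keeps \<open>g z\<close> off the cuts of both primitives.\<close>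

lemma primitive_minus_polylog_deriv:
  fixes g :: "complex \<Rightarrow> complex"
  assumes g: "(g has_field_derivative d) (at z)" and "Re (g z) > 0"
    and d: "g z \<noteq> 1 \<Longrightarrow> d * (1 / (g z - 1) - 1 / (g z - \<i>)) = 1 / z"
    and "g z = 1 \<Longrightarrow> z = 0"
  shows "((\<lambda>z. Ln_sq_primitive (g z) - Ln_sq_polylog \<i> (g z)) has_field_derivative Ln (g z) ^ 2 / z) (at z)"
proof -
  have 1: "g z \<notin> \<real>\<^sub>\<le>\<^sub>0" "g z / \<i> \<in> slit_plane"
    using assms(2) by (auto simp: complex_nonpos_Reals_iff complex_eq_iff)
  have "((\<lambda>z. Ln_sq_primitive (g z) - Ln_sq_polylog \<i> (g z)) has_field_derivative
          (Ln (g z) ^ 2 / (g z - 1)) * d - (Ln (g z) ^ 2 / (g z - \<i>)) * d) (at z)"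
    using 1 by (intro DERIV_diff DERIV_chain2[OF _ g] Ln_sq_primitive_deriv Ln_sq_polylog_deriv) auto
  moreover have "(Ln (g z) ^ 2 / (g z - 1)) * d - (Ln (g z) ^ 2 / (g z - \<i>)) * d = Ln (g z) ^ 2 / z"
  proof (cases "g z = 1")
    case False
    have "(Ln (g z) ^ 2 / (g z - 1)) * d - (Ln (g z) ^ 2 / (g z - \<i>)) * d
        = Ln (g z) ^ 2 * (d * (1 / (g z - 1) - 1 / (g z - \<i>)))"
      by (simp add: algebra_simps)
    thus ?thesis using d[OF False] by simp
  qed (use assms(4) in auto)
  ultimately show ?thesis by simp
qed

text \<open>All three arguments are Moebius images of \<open>z\<close> taking 0 to 1. The first
  fixes infinity, while the other two send it to \<open>\<i>\<close> and therefore need a second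
  primitive with pole \<open>\<i>\<close>.\<close>

definition arctan_log_primitive :: "complex \<Rightarrow> complex" where
  "arctan_log_primitive z = 2 * Ln_sq_primitive (1 + \<i> * z)
     - (Ln_sq_primitive ((1 - z) / (1 + \<i> * z)) - Ln_sq_polylog \<i> ((1 - z) / (1 + \<i> * z)))
     - (Ln_sq_primitive ((1 + \<i> * z) / (1 + z)) - Ln_sq_polylog \<i> ((1 + \<i> * z) / (1 + z)))"

lemma Re_cayley:
  assumes "0 \<le> x" "x < 1"
  shows "Re ((1 - of_real x) / (1 + \<i> * of_real x)) > 0" "Re ((1 + \<i> * of_real x) / (1 + of_real x)) > 0"
proof -
  have "1 + x\<^sup>2 > 0" using sum_power2_gt_zero_iff[of 1 x] by simp
  thus "Re ((1 - of_real x) / (1 + \<i> * of_real x)) > 0"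
    using assms by (simp add: Re_divide divide_pos_pos)
  have "Re ((1 + \<i> * of_real x) / (1 + of_real x)) = 1 / (1 + x)"
    using assms by (simp add: Re_divide power2_eq_square)
  thus "Re ((1 + \<i> * of_real x) / (1 + of_real x)) > 0" using assms by simp
qed

text \<open>At \<open>x = 0\<close> both sides vanish, the right one by \<open>x / 0 = 0\<close>.\<close>

lemma arctan_log_primitive_deriv:
  assumes x: "0 \<le> x" "x < 1"
  shows "\<exists>d. (arctan_log_primitive has_field_derivative d) (at (of_real x)) \<and>
             Im d = 2 * arctan x * ln (1 - x\<^sup>2) / x"
proof -
  define z where "z = complex_of_real x"
  have nz: "1 + \<i> * z \<noteq> 0" "1 + z \<noteq> 0" "1 - z \<noteq> 0"
    using x by (auto simp: z_def complex_eq_iff)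
  have "1 + \<i> \<noteq> 0" "1 - \<i> \<noteq> 0" by (auto simp: complex_eq_iff)
  note nz = nz this
  let ?q = "\<lambda>z. (1 - z) / (1 + \<i> * z)" and ?w = "\<lambda>z. (1 + \<i> * z) / (1 + z)"
  have q: "((\<lambda>z. Ln_sq_primitive (?q z) - Ln_sq_polylog \<i> (?q z)) has_field_derivative Ln (?q z) ^ 2 / z) (at z)"
  proof (rule primitive_minus_polylog_deriv)
    show "(?q has_field_derivative - (1 + \<i>) / (1 + \<i> * z) ^ 2) (at z)"
      using nz by (auto intro!: derivative_eq_intros simp: power2_eq_square divide_simps) (simp add: algebra_simps)
    have 1: "?q z - 1 = - z * (1 + \<i>) / (1 + \<i> * z)" "?q z - \<i> = - \<i> * (1 + \<i>) / (1 + \<i> * z)"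
      using nz by (simp_all add: field_simps)
    show "z = 0" if "?q z = 1"
    proof -
      have "1 - z = 1 + \<i> * z" using that nz by simp
      hence "z * (1 + \<i>) = 0" by (simp add: algebra_simps add_eq_0_iff)
      thus ?thesis using nz by simp
    qed
    assume "?q z \<noteq> 1"
    hence z0: "z \<noteq> 0" by auto
    \<comment> \<open>With \<open>c = 1 + \<i>\<close> and \<open>r = 1 + \<i> * z\<close>: the
      factor \<open>c\<close> of the derivative cancels against that of both differences.\<close>
    have "- c / r ^ 2 * (1 / (- z * c / r) - 1 / (- \<i> * c / r)) = (1 / z + \<i>) / r"
      if "c \<noteq> 0" "r \<noteq> 0" for c r
      using that z0 by (simp add: divide_simps power2_eq_square) (simp add: algebra_simps)
    hence "- (1 + \<i>) / (1 + \<i> * z) ^ 2 * (1 / (?q z - 1) - 1 / (?q z - \<i>)) = (1 / z + \<i>) / (1 + \<i> * z)"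
      unfolding 1 using nz by blast
    also have "1 / z + \<i> = (1 + \<i> * z) / z" using z0 by (simp add: add_divide_distrib)
    also have "\<dots> / (1 + \<i> * z) = 1 / z" using nz by simp
    finally show "- (1 + \<i>) / (1 + \<i> * z) ^ 2 * (1 / (?q z - 1) - 1 / (?q z - \<i>)) = 1 / z" .
  qed (use Re_cayley[OF x] in \<open>simp add: z_def\<close>)
  have w: "((\<lambda>z. Ln_sq_primitive (?w z) - Ln_sq_polylog \<i> (?w z)) has_field_derivative Ln (?w z) ^ 2 / z) (at z)"
  proof (rule primitive_minus_polylog_deriv)
    show "(?w has_field_derivative - (1 - \<i>) / (1 + z) ^ 2) (at z)"
      using nz by (auto intro!: derivative_eq_intros simp: power2_eq_square divide_simps) (simp add: algebra_simps)
    have 1: "?w z - 1 = - z * (1 - \<i>) / (1 + z)" "?w z - \<i> = (1 - \<i>) / (1 + z)"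
      using nz by (simp_all add: field_simps)
    show "?w z = 1 \<Longrightarrow> z = 0" using 1(1) nz by auto
    assume "?w z \<noteq> 1"
    hence "z \<noteq> 0" by auto
    thus "- (1 - \<i>) / (1 + z) ^ 2 * (1 / (?w z - 1) - 1 / (?w z - \<i>)) = 1 / z"
      unfolding 1 using nz 
      by (simp add: power2_eq_square divide_simps) (simp add: algebra_simps)
  qed (use Re_cayley[OF x] in \<open>simp add: z_def\<close>)
  have u: "((\<lambda>z. Ln_sq_primitive (1 + \<i> * z)) has_field_derivative Ln (1 + \<i> * z) ^ 2 / z) (at z)"
  proof -
    have "1 + \<i> * z \<notin> \<real>\<^sub>\<le>\<^sub>0" by (simp add: z_def complex_nonpos_Reals_iff)
    moreover have "((\<lambda>z. 1 + \<i> * z) has_field_derivative \<i>) (at z)" by (auto intro!: derivative_eq_intros)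
    ultimately have "((\<lambda>z. Ln_sq_primitive (1 + \<i> * z)) has_field_derivative
        Ln (1 + \<i> * z) ^ 2 / (1 + \<i> * z - 1) * \<i>) (at z)"
      by (intro DERIV_chain2[OF Ln_sq_primitive_deriv])
    thus ?thesis by (simp add: divide_simps)
  qed
  let ?d = "2 * (Ln (1 + \<i> * z) ^ 2 / z) - Ln (?q z) ^ 2 / z - Ln (?w z) ^ 2 / z"
  have D: "(arctan_log_primitive has_field_derivative ?d) (at z)"
    unfolding arctan_log_primitive_def[abs_def] by (intro DERIV_diff DERIV_cmult u q w)
  define a b where "a = complex_of_real (ln (1 - x))" and "b = complex_of_real (ln (1 + x))"
  define v where "v = Ln (1 + \<i> * z)"
  have "1 + \<i> * z \<notin> \<real>\<^sub>\<le>\<^sub>0" by (simp add: z_def complex_nonpos_Reals_iff)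
  hence iv: "Ln (inverse (1 + \<i> * z)) = - v" by (simp add: Ln_inverse v_def)
  \<comment> \<open>A positive real factor can be split off \<open>Ln\<close> without a branch
    correction.\<close>
  have "?q z = of_real (1 - x) * inverse (1 + \<i> * z)" by (simp add: z_def divide_inverse)
  moreover have "Ln (of_real (1 - x) * inverse (1 + \<i> * z)) = a + Ln (inverse (1 + \<i> * z))"
    using Ln_times_of_real[of "1 - x" "inverse (1 + \<i> * z)"] nz x
    unfolding a_def by (metis Ln_of_real diff_gt_0_iff_gt inverse_nonzero_iff_nonzero)
  ultimately have lq: "Ln (?q z) = a - v" using iv by simp
  have "?w z = (1 + \<i> * z) / of_real (1 + x)" by (simp add: z_def)
  hence lw: "Ln (?w z) = v - b" using Ln_divide_of_real[of "1 + x" "1 + \<i> * z"] nz x by (simp add: b_def v_def)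
  \<comment> \<open>The squares of \<open>v\<close> cancel. As \<open>a\<close> and \<open>b\<close>
    are real, the imaginary part comes from \<open>2 * v * (a + b)\<close> alone.\<close>
  have "?d = (2 * v * (a + b) - a ^ 2 - b ^ 2) / z"
    unfolding lq lw v_def[symmetric] times_divide_eq_right diff_divide_distrib[symmetric]
    by (simp add: power2_eq_square algebra_simps)
  also have "\<dots> = (2 * v * of_real (ln (1 - x\<^sup>2)) - of_real ((ln (1 - x))\<^sup>2 + (ln (1 + x))\<^sup>2)) / of_real x"
  proof -
    have "1 - x\<^sup>2 = (1 - x) * (1 + x)" by (simp add: power2_eq_square algebra_simps)
    hence "ln (1 - x\<^sup>2) = ln (1 - x) + ln (1 + x)" using x by (simp add: ln_mult)
    thus ?thesis by (simp add: a_def b_def z_def)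
  qed
  finally have "Im ?d = 2 * arctan x * ln (1 - x\<^sup>2) / x"
    by (simp add: v_def z_def Ln_1_plus_ii_times)
  thus ?thesis using D unfolding z_def by blast
qed

text \<open>Taken from the series so that the end point 1, which is on the cut of
  \<open>dilog\<close>, is included.\<close>

definition real_dilog :: "real \<Rightarrow> real" where
  "real_dilog x = Re (polylog_series 2 (of_real x))"

lemma real_dilog_sums:
  assumes "\<bar>x\<bar> \<le> 1"
  shows "(\<lambda>k. x ^ Suc k / real (Suc k) ^ 2) sums real_dilog x"
proof -
  have "Re (of_real x ^ Suc k / of_nat (Suc k) ^ 2) = x ^ Suc k / real (Suc k) ^ 2" for k
  proof -
    have "of_real x ^ Suc k / of_nat (Suc k) ^ 2 = complex_of_real (x ^ Suc k / real (Suc k) ^ 2)"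
      by simp
    thus ?thesis by (metis Re_complex_of_real)
  qed
  thus ?thesis
    using sums_Re[OF polylog_series_sums[of 2 "of_real x"]] assms
    unfolding real_dilog_def by (simp only: norm_of_real order.refl)
qed

lemma real_dilog_continuous: "continuous_on {0..1} (\<lambda>x. real_dilog (x\<^sup>2))"
  unfolding real_dilog_def
  by (intro continuous_intros continuous_on_compose2[OF polylog_series_continuous[of 2]])
     (auto simp: norm_power abs_square_le_1 power_le_one)

lemma real_dilog_deriv:
  assumes "\<bar>x\<bar> < 1"
  shows "\<exists>d. (real_dilog has_real_derivative d) (at x) \<and> x * d = - ln (1 - x)"
proof -
  have x: "complex_of_real x \<in> slit_plane" using assms by auto
  have "(dilog has_field_derivative deriv dilog (of_real x)) (at (of_real x))"
    by (rule holomorphic_derivI[OF dilog_holomorphic open_slit_plane x])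
  hence "((\<lambda>x. dilog (of_real x)) has_vector_derivative deriv dilog (of_real x)) (at x)"
    by (rule has_vector_derivative_real_field)
  hence "((\<lambda>x. Re (dilog (of_real x))) has_vector_derivative Re (deriv dilog (of_real x))) (at x)"
    by (rule bounded_linear.has_vector_derivative[OF bounded_linear_Re])
  hence "((\<lambda>x. Re (dilog (of_real x))) has_real_derivative Re (deriv dilog (of_real x))) (at x)"
    by (simp add: has_real_derivative_iff_has_vector_derivative)
  hence "(real_dilog has_real_derivative Re (deriv dilog (of_real x))) (at x)"
    by (rule has_field_derivative_transform_within_open[of _ _ _ "ball 0 1"])
       (use assms in \<open>auto simp: real_dilog_def dilog_eq_series_ball\<close>)
  moreover have "x * Re (deriv dilog (of_real x)) = - ln (1 - x)"
  proof -
    have "complex_of_real x * deriv dilog (of_real x) = - Ln (of_real (1 - x))"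
      using dilog_deriv_mult[OF x] by simp
    also have "\<dots> = - of_real (ln (1 - x))" using assms by (subst Ln_of_real) auto
    finally have "Re (of_real x * deriv dilog (of_real x)) = Re (- of_real (ln (1 - x)))" by (rule arg_cong)
    thus ?thesis by simp
  qed
  ultimately show ?thesis by blast
qed

text \<open>\<open>\<Phi>\<close> is a primitive on the half-open interval, obtained by integrating
  by parts. At 1 the argument \<open>(1 - x) / (1 + \<i> * x)\<close> reaches the branch point 0, so
  the upper end is treated as a limit.\<close>

lemma dilog_arctan_integral:
  "integral {0..1} (\<lambda>x. real_dilog (x\<^sup>2) / (1 + x\<^sup>2)) =
     pi * (ln 2)\<^sup>2 / 2 + 11 * pi ^ 3 / 48 + 4 * catalan * ln 2 - 8 * Im (trilog (1 + \<i>))"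
proof -
  define f where "f = (\<lambda>x. real_dilog (x\<^sup>2) / (1 + x\<^sup>2))"
  define \<Phi> where "\<Phi> = (\<lambda>x. arctan x * real_dilog (x\<^sup>2) + Im (arctan_log_primitive (of_real x)))"
  have pos: "1 + x\<^sup>2 \<noteq> 0" for x :: real using sum_power2_gt_zero_iff[of 1 x] by simp
  have \<Phi>: "(\<Phi> has_real_derivative f x) (at x)" if x: "0 \<le> x" "x < 1" for x
  proof -
    have x2: "\<bar>x\<^sup>2\<bar> < 1" using x by (simp add: power_less_one_iff abs_square_less_1)
    obtain d where d: "(real_dilog has_real_derivative d) (at (x\<^sup>2))" "x\<^sup>2 * d = - ln (1 - x\<^sup>2)"
      using real_dilog_deriv[OF x2] by blast
    have d': "((\<lambda>x. real_dilog (x\<^sup>2)) has_real_derivative d * (2 * x)) (at x)"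
      by (rule DERIV_chain2[where g = "\<lambda>x. x\<^sup>2", OF d(1)]) (auto intro!: derivative_eq_intros)
    obtain e where e: "(arctan_log_primitive has_field_derivative e) (at (of_real x))"
      "Im e = 2 * arctan x * ln (1 - x\<^sup>2) / x"
      using arctan_log_primitive_deriv[OF x] by blast
    have "((\<lambda>x. Im (arctan_log_primitive (of_real x))) has_vector_derivative Im e) (at x)"
      by (rule bounded_linear.has_vector_derivative[OF bounded_linear_Im has_vector_derivative_real_field[OF e(1)]])
    hence e': "((\<lambda>x. Im (arctan_log_primitive (of_real x))) has_real_derivative Im e) (at x)"
      by (simp add: has_real_derivative_iff_has_vector_derivative)
    have "(\<Phi> has_real_derivative inverse (1 + x\<^sup>2) * real_dilog (x\<^sup>2) + d * (2 * x) * arctan x + Im e) (at x)"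
      unfolding \<Phi>_def by (rule DERIV_add[OF DERIV_mult[OF DERIV_arctan d'] e'])
    \<comment> \<open>The derivative of the dilogarithm factor is compensated by the complex
      primitive; at 0 both terms vanish.\<close>
    moreover have "d * (2 * x) * arctan x + Im e = 0"
    proof (cases "x = 0")
      case False
      have "d * (2 * x) * x = 2 * (x\<^sup>2 * d)" by (simp add: power2_eq_square)
      also have "\<dots> = - 2 * ln (1 - x\<^sup>2)" by (subst d(2)) simp
      finally have "d * (2 * x) = - 2 * ln (1 - x\<^sup>2) / x" by (subst eq_divide_eq) (use False in metis)
      thus ?thesis by (simp add: e(2))
    qed (simp add: e(2))
    hence "inverse (1 + x\<^sup>2) * real_dilog (x\<^sup>2) + d * (2 * x) * arctan x + Im e = f x"
      by (simp add: f_def divide_inverse)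
    ultimately show ?thesis by (rule DERIV_cong)
  qed
  have cont: "continuous_on {0..1} f"
    unfolding f_def by (intro continuous_intros real_dilog_continuous) (use pos in auto)
  hence int: "f integrable_on {0..1}" by (rule integrable_continuous_real)
  have "((\<lambda>x. integral {0..x} f) \<longlongrightarrow> integral {0..1} f) (at 1 within {0..1})"
    using indefinite_integral_continuous_1[OF int] by (simp add: continuous_on_def)
  hence "((\<lambda>x. integral {0..x} f) \<longlongrightarrow> integral {0..1} f) (at_left 1)"
    by (simp add: at_within_Icc_at_left)
  moreover have "\<forall>\<^sub>F b in at_left (1::real). 0 < b \<and> b < 1"
    using eventually_at_left_real[of 0 "1::real"] by simp
  hence "\<forall>\<^sub>F b in at_left 1. integral {0..b} f = \<Phi> b - \<Phi> 0"
  proof eventually_elim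
    case (elim b)
    show ?case
      by (rule integral_unique, rule fundamental_theorem_of_calculus)
         (use elim \<Phi> in \<open>auto simp: has_real_derivative_iff_has_vector_derivative[symmetric]
            intro: has_field_derivative_at_within\<close>)
  qed
  ultimately have lim: "((\<lambda>b. \<Phi> b - \<Phi> 0) \<longlongrightarrow> integral {0..1} f) (at_left 1)"
    by (rule Lim_transform_eventually)
  \<comment> \<open>At 1 the third Moebius argument tends to \<open>(1 + \<i>) / 2\<close>; the
    second tends to 0, and the literal \<open>0\<close> is its contribution.\<close>
  define L where "L = arctan 1 * real_dilog 1 + (2 * Im (Ln_sq_primitive (1 + \<i>))
      - 0 - (Im (Ln_sq_primitive ((1 + \<i>) / 2)) - Im (Ln_sq_polylog \<i> ((1 + \<i>) / 2))))"
  have ev: "\<forall>\<^sub>F b in at_left (1::real). b \<in> {0<..<1}"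
    using eventually_at_left_real[of 0 "1::real"] by simp
  have id: "((\<lambda>b. b) \<longlongrightarrow> (1::real)) (at_left 1)" by (simp add: tendsto_ident_at)
  have cid: "((\<lambda>b. complex_of_real b) \<longlongrightarrow> 1) (at_left 1)" using tendsto_of_real[OF id] by simp
  have "1 + \<i> \<noteq> 0" by (simp add: complex_eq_iff)
  have "(\<Phi> \<longlongrightarrow> L) (at_left 1)"
  proof -
    have t1: "((\<lambda>b. real_dilog (b\<^sup>2)) \<longlongrightarrow> real_dilog 1) (at_left 1)"
      using real_dilog_continuous by (force simp: continuous_on_def at_within_Icc_at_left dest!: bspec[of _ _ 1])
    have t2: "((\<lambda>b. Ln_sq_primitive (1 + \<i> * of_real b)) \<longlongrightarrow> Ln_sq_primitive (1 + \<i>)) (at_left 1)"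
      by (rule isCont_tendsto_compose[OF DERIV_isCont[OF Ln_sq_primitive_deriv]])
         (auto simp: complex_nonpos_Reals_iff intro!: tendsto_eq_intros cid)
    let ?w = "\<lambda>b. (1 + \<i> * of_real b) / (1 + of_real b)" and ?q = "\<lambda>b. (1 - of_real b) / (1 + \<i> * of_real b)"
    have w: "(?w \<longlongrightarrow> (1 + \<i>) / 2) (at_left 1)" by (auto intro!: tendsto_eq_intros cid)
    have t3: "((\<lambda>b. Ln_sq_primitive (?w b)) \<longlongrightarrow> Ln_sq_primitive ((1 + \<i>) / 2)) (at_left 1)"
      by (rule isCont_tendsto_compose[OF DERIV_isCont[OF Ln_sq_primitive_deriv] w])
         (auto simp: complex_nonpos_Reals_iff)
    have t4: "((\<lambda>b. Ln_sq_polylog \<i> (?w b)) \<longlongrightarrow> Ln_sq_polylog \<i> ((1 + \<i>) / 2)) (at_left 1)"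
      by (rule isCont_tendsto_compose[OF DERIV_isCont[OF Ln_sq_polylog_deriv] w])
         (auto simp: complex_nonpos_Reals_iff complex_eq_iff)
    have q: "(?q \<longlongrightarrow> 0) (at_left 1)" using \<open>1 + \<i> \<noteq> 0\<close> by (auto intro!: tendsto_eq_intros cid)
    have q0: "\<forall>\<^sub>F b in at_left 1. ?q b \<noteq> 0"
      using ev
    proof eventually_elim
      case (elim b)
      have "1 + \<i> * complex_of_real b \<noteq> 0" "1 - complex_of_real b \<noteq> 0"
        using elim by (auto simp: complex_eq_iff)
      thus ?case by simp
    qed
    \<comment> \<open>Near the branch point the primitive is replaced by its polylogarithmic form,
      which has the same imaginary part and a known limit.\<close>
    have "((\<lambda>b. Im (Ln_sq_polylog 1 (?q b)) - Im (Ln_sq_polylog \<i> (?q b))) \<longlongrightarrow> Im 0 - Im 0) (at_left 1)"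
      by (intro tendsto_intros Ln_sq_polylog_tendsto_0 q q0) auto
    hence "((\<lambda>b. Im (Ln_sq_polylog 1 (?q b)) - Im (Ln_sq_polylog \<i> (?q b))) \<longlongrightarrow> 0) (at_left 1)" by simp
    hence t5: "((\<lambda>b. Im (Ln_sq_primitive (?q b)) - Im (Ln_sq_polylog \<i> (?q b))) \<longlongrightarrow> 0) (at_left 1)"
    proof (rule Lim_transform_eventually, use ev in eventually_elim)
      case (elim b)
      have "1 + b\<^sup>2 > 0" using pos[of b] by (simp add: add_pos_nonneg)
      hence "Im (?q b) < 0" using elim by (simp add: Im_divide divide_neg_pos algebra_simps)
      hence "?q b \<in> slit_plane" "?q b \<notin> \<real>\<^sub>\<le>\<^sub>0"
        by (auto simp: complex_nonpos_Reals_iff)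
      thus ?case using Im_Ln_sq_polylog_1 by simp
    qed
    have "((\<lambda>b. arctan b * real_dilog (b\<^sup>2) + (2 * Im (Ln_sq_primitive (1 + \<i> * of_real b))
        - (Im (Ln_sq_primitive (?q b)) - Im (Ln_sq_polylog \<i> (?q b)))
        - (Im (Ln_sq_primitive (?w b)) - Im (Ln_sq_polylog \<i> (?w b))))) \<longlongrightarrow> L) (at_left 1)"
      unfolding L_def by (intro tendsto_intros t1 t2 t3 t4 t5 id)
    thus ?thesis by (simp add: \<Phi>_def[abs_def] arctan_log_primitive_def)
  qed
  hence "((\<lambda>b. \<Phi> b - \<Phi> 0) \<longlongrightarrow> L - \<Phi> 0) (at_left 1)" by (intro tendsto_intros)
  hence "integral {0..1} f = L - \<Phi> 0"
    using lim tendsto_unique[OF trivial_limit_at_left_real] by blast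
  \<comment> \<open>At 0 all three arguments are 1, where \<open>Ln_sq_primitive\<close> vanishes by
    normalization.\<close>
  also have "\<Phi> 0 = 2 * Im (Ln_sq_polylog \<i> 1)"
    by (simp add: \<Phi>_def arctan_log_primitive_def)
  also have "Im (Ln_sq_polylog \<i> 1) = pi ^ 3 / 16"
    using Im_trilog_minus_ii by (simp add: Ln_sq_polylog_def)
  also have "L = pi ^ 3 / 24 + 4 * Im (Ln_sq_primitive (1 + \<i>)) + pi ^ 3 / 16"
    using Im_Ln_sq_polylog_ii_half
    by (simp add: L_def real_dilog_def polylog_series_2_1 arctan_one power2_eq_square power3_eq_cube)
  finally show ?thesis
    unfolding f_def Im_Ln_sq_primitive_1_plus_ii by (simp add: field_simps)
qed

subsection \<open>The moments of the arctangent kernel\<close>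

definition arctan_moment :: "nat \<Rightarrow> real" where
  "arctan_moment l = integral {0..1} (\<lambda>x. x ^ (2 * l) / (1 + x\<^sup>2))"

lemma arctan_moment_integrable: "(\<lambda>x::real. x ^ (2 * l) / (1 + x\<^sup>2)) integrable_on {0..1}"
proof (rule integrable_continuous_real)
  have "1 + x\<^sup>2 \<noteq> 0" for x :: real using sum_power2_gt_zero_iff[of 1 x] by simp
  thus "continuous_on {0..1} (\<lambda>x::real. x ^ (2 * l) / (1 + x\<^sup>2))"
    by (intro continuous_intros) auto
qed

lemma arctan_moment_rec: "arctan_moment l + arctan_moment (Suc l) = 1 / (2 * real l + 1)"
proof -
  have pos: "1 + x\<^sup>2 \<noteq> 0" for x :: real using sum_power2_gt_zero_iff[of 1 x] by simp
  have "arctan_moment l + arctan_moment (Suc l)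
      = integral {0..1} (\<lambda>x. x ^ (2 * l) / (1 + x\<^sup>2) + x ^ (2 * Suc l) / (1 + x\<^sup>2))"
    unfolding arctan_moment_def
    by (rule integral_add[symmetric]) (rule arctan_moment_integrable)+
  also have "(\<lambda>x::real. x ^ (2 * l) / (1 + x\<^sup>2) + x ^ (2 * Suc l) / (1 + x\<^sup>2)) = (\<lambda>x. x ^ (2 * l))"
  proof
    fix x :: real
    have "x ^ (2 * l) / (1 + x\<^sup>2) + x ^ (2 * Suc l) / (1 + x\<^sup>2) = x ^ (2 * l) * (1 + x\<^sup>2) / (1 + x\<^sup>2)"
      by (simp add: power_add power2_eq_square algebra_simps flip: add_divide_distrib)
    thus "x ^ (2 * l) / (1 + x\<^sup>2) + x ^ (2 * Suc l) / (1 + x\<^sup>2) = x ^ (2 * l)" using pos by simp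
  qed
  also have "integral {0..1} (\<lambda>x::real. x ^ (2 * l)) = 1 / (2 * real l + 1)"
  proof (rule integral_unique)
    have d: "((\<lambda>x::real. x ^ (2 * l + 1) / (2 * real l + 1)) has_real_derivative x ^ (2 * l)) (at x within A)" for x and A :: "real set"
      by (rule DERIV_cong[OF DERIV_cdivide[OF DERIV_pow]]) (simp add: add_ac)
    have "((\<lambda>x::real. x ^ (2 * l)) has_integral (1 ^ (2 * l + 1) / (2 * real l + 1) - 0 ^ (2 * l + 1) / (2 * real l + 1))) {0..1}"
      by (rule fundamental_theorem_of_calculus)
         (simp_all only: has_real_derivative_iff_has_vector_derivative[symmetric] d zero_le_one)
    thus "((\<lambda>x::real. x ^ (2 * l)) has_integral 1 / (2 * real l + 1)) {0..1}" by simp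
  qed
  finally show ?thesis .
qed

lemma arctan_moment_0: "arctan_moment 0 = pi / 4"
  unfolding arctan_moment_def
proof (rule integral_unique)
  have "((\<lambda>x::real. inverse (1 + x\<^sup>2)) has_integral (arctan 1 - arctan 0)) {0..1}"
    by (rule fundamental_theorem_of_calculus)
       (auto intro!: DERIV_arctan has_field_derivative_at_within simp: has_real_derivative_iff_has_vector_derivative[symmetric])
  thus "((\<lambda>x::real. x ^ (2 * 0) / (1 + x\<^sup>2)) has_integral pi / 4) {0..1}"
    by (simp add: inverse_eq_divide)
qed

text \<open>The recurrence unrolled from \<open>pi / 4\<close>: up to sign, a moment is a remainder
  of Leibniz's series.\<close>

lemma arctan_moment_eq:
  "arctan_moment l = (-1) ^ l * (pi / 4 - (\<Sum>j<l. (-1) ^ j / (2 * real j + 1)))"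
proof (induction l)
  case (Suc l)
  have "arctan_moment (Suc l) = 1 / (2 * real l + 1) - arctan_moment l"
    using arctan_moment_rec[of l] by simp
  also have "\<dots> = 1 / (2 * real l + 1) - (-1) ^ l * (pi / 4 - (\<Sum>j<l. (-1) ^ j / (2 * real j + 1)))"
    by (simp add: Suc)
  also have "1 / (2 * real l + 1) = (-1) ^ l * ((-1) ^ l / (2 * real l + 1))"
    by (simp flip: power_mult_distrib)
  finally have "arctan_moment (Suc l) = \<dots> - (-1) ^ l * (pi / 4 - (\<Sum>j<l. (-1) ^ j / (2 * real j + 1)))" .
  moreover have "c * e - c * (p - s) = - 1 * c * (p - (s + e))" for c e p s :: real
    by (simp add: algebra_simps)
  ultimately show ?case by (simp only: sum.lessThan_Suc power_Suc)
qed (simp add: arctan_moment_0)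

section \<open>Moments, digamma differences and the dilogarithm integral\<close>

lemma arctan_moment_nonneg: "0 \<le> arctan_moment l"
  unfolding arctan_moment_def
  by (rule integral_nonneg[OF arctan_moment_integrable]) (auto intro!: divide_nonneg_nonneg add_nonneg_nonneg)

lemma arctan_moment_le: "arctan_moment l \<le> 1 / (2 * real l + 1)"
  using arctan_moment_rec[of l] arctan_moment_nonneg[of "Suc l"] by simp

lemma inverse_odd_tendsto_0: "(\<lambda>l. 1 / (2 * real l + 1)) \<longlonglongrightarrow> 0"
  by real_asymp

text \<open>Both sides are null sequences with the same sum of consecutive terms. Their difference
  thus alternates in sign with constant modulus and tends to 0, so it is 0.\<close>

lemma Digamma_diff_eq_arctan_moment:
  "Digamma ((2 * real l + 5) / 4) - Digamma ((2 * real l + 3) / 4) = 4 * arctan_moment (Suc l)"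
proof -
  define g where "g = (\<lambda>l. Digamma ((2 * real l + 5) / 4) - Digamma ((2 * real l + 3) / 4))"
  have rec: "g l + g (Suc l) = 4 / (2 * real l + 3)" for l
  proof -
    have "Digamma ((2 * real l + 3) / 4 + 1) = Digamma ((2 * real l + 3) / 4) + 1 / ((2 * real l + 3) / 4)"
      by (rule Digamma_plus1) auto
    hence "Digamma ((2 * real l + 7) / 4) = Digamma ((2 * real l + 3) / 4) + 4 / (2 * real l + 3)"
      by (simp add: add_divide_distrib add_ac) (simp add: field_simps)
    moreover have "(2 * real (Suc l) + 5) / 4 = (2 * real l + 7) / 4" "(2 * real (Suc l) + 3) / 4 = (2 * real l + 5) / 4"
      by simp_all
    ultimately show ?thesis unfolding g_def by (simp only:)
  qed
  have nonneg: "0 \<le> g l" for l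
    unfolding g_def using Digamma_real_mono[of "(2 * real l + 3) / 4" "(2 * real l + 5) / 4"] by simp
  have "g l \<le> 4 / (2 * real l + 3)" for l using rec[of l] nonneg[of "Suc l"] by simp
  hence "g \<longlonglongrightarrow> 0"
    using nonneg by (intro real_tendsto_sandwich[of "\<lambda>_. 0" g sequentially "\<lambda>l. 4 / (2 * real l + 3)"]) (auto, real_asymp)
  moreover have "arctan_moment \<longlonglongrightarrow> 0"
    by (rule real_tendsto_sandwich[of "\<lambda>_. 0" _ _ "\<lambda>l. 1 / (2 * real l + 1)"])
       (auto simp: arctan_moment_nonneg arctan_moment_le inverse_odd_tendsto_0)
  ultimately have "(\<lambda>l. g l - 4 * arctan_moment (Suc l)) \<longlonglongrightarrow> 0 - 4 * 0"
    by (intro tendsto_diff tendsto_mult tendsto_const LIMSEQ_Suc)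
  hence lim: "(\<lambda>l. \<bar>g l - 4 * arctan_moment (Suc l)\<bar>) \<longlonglongrightarrow> 0"
    using tendsto_rabs_zero by force
  have "g (Suc l) - 4 * arctan_moment (Suc (Suc l)) = - (g l - 4 * arctan_moment (Suc l))" for l
    using rec[of l] arctan_moment_rec[of "Suc l"] by (simp add: add_ac)
  hence const: "\<bar>g l - 4 * arctan_moment (Suc l)\<bar> = \<bar>g 0 - 4 * arctan_moment (Suc 0)\<bar>" for l
    by (induction l) (simp_all only: abs_minus)
  have "(\<lambda>l::nat. \<bar>g 0 - 4 * arctan_moment (Suc 0)\<bar>) \<longlonglongrightarrow> 0"
    using lim by (subst (asm) const)
  hence "\<bar>g l - 4 * arctan_moment (Suc l)\<bar> = 0"
    by (subst const) (simp add: LIMSEQ_const_iff)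
  thus ?thesis by (simp add: g_def)
qed

text \<open>The dilogarithm series in \<open>x\<^sup>2\<close> is integrated termwise; domination by
  the inverse squares makes the convergence uniform up to 1.\<close>

lemma arctan_moment_dilog_sums:
  "(\<lambda>l. arctan_moment (Suc l) / (real (Suc l))\<^sup>2) sums integral {0..1} (\<lambda>x. real_dilog (x\<^sup>2) / (1 + x\<^sup>2))"
proof -
  have pos: "1 + x\<^sup>2 \<noteq> 0" "1 \<le> 1 + x\<^sup>2" for x :: real using sum_power2_gt_zero_iff[of 1 x] by auto
  define t where "t = (\<lambda>k x. x ^ (2 * Suc k) / (1 + x\<^sup>2) / (real (Suc k))\<^sup>2 :: real)"
  have "uniform_limit {0..1} (\<lambda>n x. \<Sum>k<n. t k x) (\<lambda>x. \<Sum>k. t k x) sequentially"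
  proof (rule Weierstrass_m_test[OF _ summable_inverse_power_Suc[of 2]])
    fix k and x :: real assume x: "x \<in> {0..1}"
    have "x ^ (2 * Suc k) / (1 + x\<^sup>2) \<le> 1 / 1"
      using x pos by (intro frac_le power_le_one) auto
    from divide_right_mono[OF this, of "(real (Suc k))\<^sup>2"]
    have "t k x \<le> 1 / real (Suc k) ^ 2" unfolding t_def by simp
    moreover have "0 \<le> t k x"
      unfolding t_def using x pos(2)[of x] by (intro divide_nonneg_nonneg zero_le_power) auto
    ultimately show "norm (t k x) \<le> 1 / real (Suc k) ^ 2" by simp
  qed simp
  moreover have "(\<Sum>k. t k x) = real_dilog (x\<^sup>2) / (1 + x\<^sup>2)" if "x \<in> {0..1}" for x
  proof -
    have "\<bar>x\<^sup>2\<bar> \<le> 1" using that by (simp add: power_le_one abs_square_le_1)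
    from sums_divide[OF real_dilog_sums[OF this], of "1 + x\<^sup>2"]
    have "(\<lambda>k. t k x) sums (real_dilog (x\<^sup>2) / (1 + x\<^sup>2))"
      by (simp add: t_def field_simps flip: power_mult del: of_nat_Suc power_Suc)
    thus ?thesis by (simp add: sums_iff)
  qed
  ultimately have ul: "uniform_limit {0..1} (\<lambda>n x. \<Sum>k<n. t k x) (\<lambda>x. real_dilog (x\<^sup>2) / (1 + x\<^sup>2)) sequentially"
    by (subst uniform_limit_cong'[where g = "\<lambda>n x. \<Sum>k<n. t k x" and i = "\<lambda>x. \<Sum>k. t k x"]) auto
  have int: "t k integrable_on {0..1}" for k
    unfolding t_def by (intro integrable_on_divide arctan_moment_integrable)
  have ti: "integral {0..1} (t k) = arctan_moment (Suc k) / (real (Suc k))\<^sup>2" for k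
    unfolding t_def arctan_moment_def by (rule integral_divide)
  have cont: "continuous_on {0..1} (\<lambda>x. \<Sum>k<n. t k x)" for n
    unfolding t_def using pos by (intro continuous_intros) auto
  obtain I J where IJ: "\<And>n. ((\<lambda>x. \<Sum>k<n. t k x) has_integral I n) {0..1}"
     "((\<lambda>x. real_dilog (x\<^sup>2) / (1 + x\<^sup>2)) has_integral J) {0..1}" "I \<longlonglongrightarrow> J"
    using uniform_limit_integral[OF ul cont sequentially_bot] by blast
  have "I = (\<lambda>n. \<Sum>k<n. arctan_moment (Suc k) / (real (Suc k))\<^sup>2)"
  proof
    fix n
    show "I n = (\<Sum>k<n. arctan_moment (Suc k) / (real (Suc k))\<^sup>2)"
      using integral_unique[OF IJ(1)[of n]] integral_sum[of "{..<n}" t "{0..1}"] int by (simp add: ti)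
  qed
  thus ?thesis using IJ(3) integral_unique[OF IJ(2)] by (simp only: sums_def)
qed

subsection \<open>The series\<close>

definition odd_quadratic_sum :: "nat \<Rightarrow> real" where
  "odd_quadratic_sum N = (\<Sum>k. 1 / ((real (Suc k))\<^sup>2 * (2 * real (Suc k) + 2 * real N + 1)))"

text \<open>The sum \<open>S d\<close> of the overview, with \<open>l\<close> ranging over
  \<open>Suc k\<close>.\<close>

definition arctan_moment_sum :: "nat \<Rightarrow> real" where
  "arctan_moment_sum d = (\<Sum>k. arctan_moment (Suc k + d + 1) / (real (Suc k))\<^sup>2)"

text \<open>The even terms of \<open>harm (2 * N + 1)\<close> make up half of
  \<open>harm N\<close>.\<close>

lemma sum_odd_harm: "(\<Sum>k<Suc N. 2 / (2 * real k + 1)) = 2 * harm (2 * N + 1) - harm N"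
proof (induction N)
  case (Suc N)
  have "2 * harm (2 * Suc N + 1) - harm (Suc N)
     = 2 * harm (2 * N + 1) - harm N + 2 * inverse (2 * real N + 2) + 2 * inverse (2 * real N + 3) - inverse (real N + 1)"
    by (simp add: harm_Suc add_ac)
  also have "2 * inverse (2 * real N + 2) = inverse (real N + 1)"
    by (simp add: divide_simps)
  finally have "2 * harm (2 * Suc N + 1) - harm (Suc N)
     = (2 * harm (2 * N + 1) - harm N) + 2 / (2 * real (Suc N) + 1)"
    by (simp add: inverse_eq_divide add_ac)
  thus ?case by (simp only: Suc sum.lessThan_Suc[of _ "Suc N"])
qed (simp add: harm_expand)

text \<open>Partial fractions, with \<open>c = 2 * N + 1\<close> and \<open>x = Suc k\<close>: a
  multiple of \<open>1 / x\<^sup>2\<close> gives the Basel sum, and a multiple of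
  \<open>1 / x - 2 / (2 * x + c)\<close> gives a digamma value.\<close>

lemma odd_quadratic_sums:
  "(\<lambda>k. 1 / ((real (Suc k))\<^sup>2 * (2 * real (Suc k) + 2 * real N + 1))) sums
     (pi\<^sup>2 / (6 * (2 * real N + 1)) - 2 / (2 * real N + 1)\<^sup>2 * (2 * harm (2 * N + 1) - harm N - 2 * ln 2))"
proof -
  define c where "c = 2 * real N + 1"
  \<comment> \<open>Chosen so that \<open>z + k\<close> is half of \<open>2 * Suc k + c\<close>; at
    such half-integers \<open>Digamma\<close> reduces to harmonic numbers and
    \<open>ln 2\<close>.\<close>
  define z where "z = of_nat (Suc N) + 1 / (2 :: real)"
  have c: "c > 0" by (simp add: c_def)
  have "z \<noteq> 0" by (simp add: z_def)
  have "(\<lambda>k. inverse (real (Suc k)) - inverse (z + real k)) sums (Digamma z + euler_mascheroni)"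
    unfolding Digamma_def using summable_sums[OF summable_Digamma[OF \<open>z \<noteq> 0\<close>]] by simp
  also have "Digamma z + euler_mascheroni = 2 * harm (2 * N + 1) - harm N - 2 * ln 2"
    unfolding z_def Digamma_half_integer using sum_odd_harm[of N] by (simp add: add_ac)
  finally have Dg: "(\<lambda>k. inverse (real (Suc k)) - inverse (z + real k)) sums (2 * harm (2 * N + 1) - harm N - 2 * ln 2)" .
  have "(\<lambda>k. 1 / c * (1 / (real k + 1)\<^sup>2) - 2 / c\<^sup>2 * (inverse (real (Suc k)) - inverse (z + real k)))
     sums (1 / c * (pi\<^sup>2 / 6) - 2 / c\<^sup>2 * (2 * harm (2 * N + 1) - harm N - 2 * ln 2))"
    using inverse_squares_sums by (intro sums_diff[OF sums_mult sums_mult[OF Dg]]) (simp add: add_ac)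
  moreover have "1 / c * (1 / (real k + 1)\<^sup>2) - 2 / c\<^sup>2 * (inverse (real (Suc k)) - inverse (z + real k))
     = 1 / ((real (Suc k))\<^sup>2 * (2 * real (Suc k) + 2 * real N + 1))" for k
  proof -
    define x where "x = real (Suc k)"
    have x: "x > 0" by (simp add: x_def)
    have zk: "z + real k = (2 * x + c) / 2" by (simp add: z_def x_def c_def field_simps)
    have "1 / c * (1 / (real k + 1)\<^sup>2) - 2 / c\<^sup>2 * (inverse (real (Suc k)) - inverse (z + real k))
       = 1 / c * (1 / x\<^sup>2) - 2 / c\<^sup>2 * (1 / x - 2 / (2 * x + c))"
      unfolding zk by (simp add: x_def inverse_eq_divide add_ac)
    also have "\<dots> = 1 / (x\<^sup>2 * (2 * x + c))"
    proof -
      have "2 * x + c > 0" using x c by simp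
      hence "1 / x - 2 / (2 * x + c) = c / (x * (2 * x + c))" using x by (simp add: field_simps)
      hence "1 / c * (1 / x\<^sup>2) - 2 / c\<^sup>2 * (1 / x - 2 / (2 * x + c)) = 1 / c * (1 / x\<^sup>2 - 2 / (x * (2 * x + c)))"
        using c by (simp add: power2_eq_square right_diff_distrib)
      also have "1 / x\<^sup>2 - 2 / (x * (2 * x + c)) = c / (x\<^sup>2 * (2 * x + c))"
        using x \<open>2 * x + c > 0\<close> by (simp add: power2_eq_square divide_simps)
      finally show ?thesis using c by simp
    qed
    finally show ?thesis by (simp add: x_def c_def add_ac)
  qed
  ultimately show ?thesis by (simp add: c_def)
qed

lemma odd_quadratic_sum_eq:
  "odd_quadratic_sum N = pi\<^sup>2 / (6 * (2 * real N + 1))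
     - 2 / (2 * real N + 1)\<^sup>2 * (2 * harm (2 * N + 1) - harm N - 2 * ln 2)"
  using odd_quadratic_sums[of N] by (simp add: odd_quadratic_sum_def sums_iff)

text \<open>The increment of \<open>arctan_moment_sum\<close> when its argument grows by two,
  arranged like the summands of the theorem.\<close>

lemma odd_quadratic_sum_diff:
  fixes N :: nat
  defines "c \<equiv> 2 * real N + 1"
  shows "odd_quadratic_sum (Suc N) - odd_quadratic_sum N =
    8 * ((c + 1) * (2 * harm (2 * N + 1) - harm N) / ((c + 2)\<^sup>2 * c\<^sup>2)) - 4 * (1 / (c + 2) ^ 3)
    - pi\<^sup>2 * (1 / 3 * (1 / ((c + 2) * c))) - 16 * (ln 2 * ((c + 1) / ((c + 2)\<^sup>2 * c\<^sup>2)))"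
proof -
  define H :: real where "H = 2 * harm (2 * N + 1) - harm N"
  have c: "c > 0" "c + 2 > 0" by (simp_all add: c_def)
  \<comment> \<open>The extra \<open>2 / (c + 2)\<close> is the source of the cubic
    denominator.\<close>
  have H: "2 * harm (2 * Suc N + 1) - harm (Suc N) = H + 2 / (c + 2)"
    unfolding H_def sum_odd_harm[symmetric] by (simp add: c_def add_ac)
  have c2: "2 * real (Suc N) + 1 = c + 2" by (simp add: c_def)
  have "1 / (c + 2) - 1 / c = - 2 * (1 / ((c + 2) * c))"
    using c by (simp add: field_simps)
  moreover have "pi\<^sup>2 / (6 * (c + 2)) - pi\<^sup>2 / (6 * c) = pi\<^sup>2 / 6 * (1 / (c + 2) - 1 / c)"
    by (simp add: right_diff_distrib)
  ultimately have 1: "pi\<^sup>2 / (6 * (c + 2)) - pi\<^sup>2 / (6 * c) = - (pi\<^sup>2 * (1 / 3 * (1 / ((c + 2) * c))))"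
    by simp
  \<comment> \<open>The numerator comes from
    \<open>(c + 2)\<^sup>2 - c\<^sup>2 = 4 * (c + 1)\<close>.\<close>
  have 2: "1 / c\<^sup>2 - 1 / (c + 2)\<^sup>2 = 4 * ((c + 1) / ((c + 2)\<^sup>2 * c\<^sup>2))"
    using c by (simp add: divide_simps power2_eq_square) (simp add: algebra_simps)
  have "odd_quadratic_sum N = pi\<^sup>2 / (6 * c) - 2 / c\<^sup>2 * (H - 2 * ln 2)"
    unfolding odd_quadratic_sum_eq by (simp add: c_def H_def)
  moreover have "odd_quadratic_sum (Suc N) = pi\<^sup>2 / (6 * (c + 2)) - 2 / (c + 2)\<^sup>2 * (H + 2 / (c + 2) - 2 * ln 2)"
    unfolding odd_quadratic_sum_eq H c2 ..
  moreover have "a - 2 / r * (h + t - l) - (b - 2 / s * (h - l)) = a - b + 2 * (h - l) * (1 / s - 1 / r) - 2 / r * t"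
    for a b r s t h l :: real
    by (simp add: field_split_simps)
  ultimately have "odd_quadratic_sum (Suc N) - odd_quadratic_sum N =
     (pi\<^sup>2 / (6 * (c + 2)) - pi\<^sup>2 / (6 * c)) + 2 * (H - 2 * ln 2) * (1 / c\<^sup>2 - 1 / (c + 2)\<^sup>2)
     - 2 / (c + 2)\<^sup>2 * (2 / (c + 2))"
    by (simp only:)
  also have "2 / (c + 2)\<^sup>2 * (2 / (c + 2)) = 4 * (1 / (c + 2) ^ 3)"
    by (simp add: power2_eq_square power3_eq_cube)
  finally have "odd_quadratic_sum (Suc N) - odd_quadratic_sum N =
    - (pi\<^sup>2 * (1 / 3 * (1 / ((c + 2) * c)))) + 2 * (H - 2 * ln 2) * (4 * ((c + 1) / ((c + 2)\<^sup>2 * c\<^sup>2)))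
    - 4 * (1 / (c + 2) ^ 3)"
    unfolding 1 2 .
  moreover have "- p + 2 * (h - 2 * l) * (4 * (x / y)) - t = 8 * (x * h / y) - t - p - 16 * (l * (x / y))"
    for p h l x y t :: real
    by (simp add: field_split_simps)
  ultimately show ?thesis unfolding H_def by (simp only:)
qed

section \<open>Closed forms of the moment sums by recurrence\<close>

lemma arctan_moment_sums:
  "(\<lambda>k. arctan_moment (Suc k + d + 1) / (real (Suc k))\<^sup>2) sums arctan_moment_sum d"
proof -
  have "summable (\<lambda>k. arctan_moment (Suc k + d + 1) / (real (Suc k))\<^sup>2)"
  proof (rule summable_comparison_test'[OF summable_inverse_power_Suc[of 2]])
    fix k :: nat
    have "arctan_moment (Suc k + d + 1) \<le> 1 / (2 * real (Suc k + d + 1) + 1)" by (rule arctan_moment_le)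
    also have "\<dots> \<le> 1" by simp
    finally show "norm (arctan_moment (Suc k + d + 1) / (real (Suc k))\<^sup>2) \<le> 1 / real (Suc k) ^ 2"
      using arctan_moment_nonneg[of "Suc k + d + 1"] by (simp add: divide_right_mono del: of_nat_Suc)
  qed simp
  thus ?thesis by (simp add: arctan_moment_sum_def summable_sums)
qed

lemma arctan_moment_sum_rec: "arctan_moment_sum d + arctan_moment_sum (Suc d) = odd_quadratic_sum (Suc d)"
proof -
  have "arctan_moment (Suc k + d + 1) / (real (Suc k))\<^sup>2 + arctan_moment (Suc k + Suc d + 1) / (real (Suc k))\<^sup>2
      = 1 / ((real (Suc k))\<^sup>2 * (2 * real (Suc k) + 2 * real (Suc d) + 1))" for k
    using arctan_moment_rec[of "Suc k + d + 1"] by (simp add: add_divide_distrib[symmetric] add_ac mult.commute)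
  hence "(\<lambda>k. 1 / ((real (Suc k))\<^sup>2 * (2 * real (Suc k) + 2 * real (Suc d) + 1))) sums
      (arctan_moment_sum d + arctan_moment_sum (Suc d))"
    using sums_add[OF arctan_moment_sums[of d] arctan_moment_sums[of "Suc d"]] by simp
  thus ?thesis by (simp add: odd_quadratic_sum_def sums_iff)
qed

text \<open>The recurrence one step earlier: the integral plays the role of the moment sum at
  \<open>d = - 1\<close>.\<close>

lemma arctan_moment_sum_0:
  "arctan_moment_sum 0 = odd_quadratic_sum 0 - integral {0..1} (\<lambda>x. real_dilog (x\<^sup>2) / (1 + x\<^sup>2))"
    (is "_ = _ - ?I")
proof -
  have "arctan_moment (Suc k) / (real (Suc k))\<^sup>2 + arctan_moment (Suc k + 0 + 1) / (real (Suc k))\<^sup>2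
      = 1 / ((real (Suc k))\<^sup>2 * (2 * real (Suc k) + 2 * real 0 + 1))" for k
    using arctan_moment_rec[of "Suc k"] by (simp add: add_divide_distrib[symmetric] add_ac mult.commute)
  hence "(\<lambda>k. 1 / ((real (Suc k))\<^sup>2 * (2 * real (Suc k) + 2 * real 0 + 1))) sums (?I + arctan_moment_sum 0)"
    using sums_add[OF arctan_moment_dilog_sums arctan_moment_sums[of 0]] by simp
  thus ?thesis by (simp add: odd_quadratic_sum_def sums_iff)
qed

lemma arctan_moment_sum_add_2:
  "arctan_moment_sum (Suc (Suc d)) = arctan_moment_sum d + (odd_quadratic_sum (Suc (Suc d)) - odd_quadratic_sum (Suc d))"
  using arctan_moment_sum_rec[of d] arctan_moment_sum_rec[of "Suc d"] by simp

text \<open>Steps of two starting from \<open>arctan_moment_sum 0\<close>; the increments have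
  \<open>c = 4 * J + 3\<close>.\<close>

lemma arctan_moment_sum_even:
  "arctan_moment_sum (2 * J) = - 4
     + 32 * (\<Sum>j<J. (real j + 1) * (2 * harm (4 * j + 3) - harm (2 * j + 1)) / ((4 * real j + 5)\<^sup>2 * (4 * real j + 3)\<^sup>2))
     - 4 * (\<Sum>j<J. 1 / (4 * real j + 5) ^ 3)
     + pi\<^sup>2 * (1 / 6 - 1 / 3 * (\<Sum>j<J. 1 / ((4 * real j + 5) * (4 * real j + 3))))
     + ln 2 * (4 - 64 * (\<Sum>j<J. (real j + 1) / ((4 * real j + 5)\<^sup>2 * (4 * real j + 3)\<^sup>2)))
     - integral {0..1} (\<lambda>x. real_dilog (x\<^sup>2) / (1 + x\<^sup>2))"
proof (induction J)
  case 0
  show ?case by (simp add: arctan_moment_sum_0 odd_quadratic_sum_eq harm_expand)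
next
  case (Suc J)
  have c: "4 * real J + 3 + 2 = 4 * real J + 5" "2 * real (Suc (2 * J)) + 1 = 4 * real J + 3"
    "4 * real J + 3 + 1 = 4 * (real J + 1)" "2 * Suc (2 * J) + 1 = 4 * J + 3" "Suc (2 * J) = 2 * J + 1"
    by simp_all
  \<comment> \<open>The factor 4 in \<open>c + 1 = 4 * (J + 1)\<close> turns the coefficients 8 and
    16 into 32 and 64.\<close>
  have gen: "8 * (4 * x * h / y) - a - b - 16 * (l * (4 * x / y)) = 32 * (x * h / y) - a - b - 64 * (l * (x / y))"
    for x h y a b l :: real
    by simp
  have "arctan_moment_sum (2 * Suc J) = arctan_moment_sum (2 * J)
      + (odd_quadratic_sum (Suc (Suc (2 * J))) - odd_quadratic_sum (Suc (2 * J)))"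
    using arctan_moment_sum_add_2[of "2 * J"] by simp
  also have "odd_quadratic_sum (Suc (Suc (2 * J))) - odd_quadratic_sum (Suc (2 * J)) =
      32 * ((real J + 1) * (2 * harm (4 * J + 3) - harm (2 * J + 1)) / ((4 * real J + 5)\<^sup>2 * (4 * real J + 3)\<^sup>2))
      - 4 * (1 / (4 * real J + 5) ^ 3) - pi\<^sup>2 * (1 / 3 * (1 / ((4 * real J + 5) * (4 * real J + 3))))
      - 64 * (ln 2 * ((real J + 1) / ((4 * real J + 5)\<^sup>2 * (4 * real J + 3)\<^sup>2)))"
    unfolding odd_quadratic_sum_diff[of "Suc (2 * J)"] c(1-4) unfolding c(5) by (rule gen)
  finally show ?case unfolding Suc sum.lessThan_Suc by (simp only: ring_distribs)
qed

text \<open>Starting one step later reverses the sign of the integral; the increments now have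
  \<open>c = 4 * j + 1\<close>.\<close>

lemma arctan_moment_sum_odd:
  "arctan_moment_sum (2 * J + 1) = 92 / 27
     + 16 * (\<Sum>j=1..J. (2 * real j + 1) * (2 * harm (4 * j + 1) - harm (2 * j)) / ((4 * real j + 3)\<^sup>2 * (4 * real j + 1)\<^sup>2))
     - 4 * (\<Sum>j=1..J. 1 / (4 * real j + 3) ^ 3)
     - pi\<^sup>2 * (1 / 9 + 1 / 3 * (\<Sum>j=1..J. 1 / ((4 * real j + 3) * (4 * real j + 1))))
     - ln 2 * (32 / 9 + 32 * (\<Sum>j=1..J. (2 * real j + 1) / ((4 * real j + 3)\<^sup>2 * (4 * real j + 1)\<^sup>2)))
     + integral {0..1} (\<lambda>x. real_dilog (x\<^sup>2) / (1 + x\<^sup>2))"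
proof (induction J)
  case 0
  have "arctan_moment_sum 1 = odd_quadratic_sum (Suc 0) - odd_quadratic_sum 0
      + integral {0..1} (\<lambda>x. real_dilog (x\<^sup>2) / (1 + x\<^sup>2))"
    using arctan_moment_sum_rec[of 0] arctan_moment_sum_0 by simp
  \<comment> \<open>The increment at \<open>N = 0\<close>, that is \<open>c = 1\<close>, supplies
    the isolated constants.\<close>
  also have "odd_quadratic_sum (Suc 0) - odd_quadratic_sum 0 = 92 / 27 - pi\<^sup>2 * (1 / 9) - ln 2 * (32 / 9)"
    unfolding odd_quadratic_sum_diff by (simp add: harm_expand)
  finally show ?case by simp
next
  case (Suc J)
  define j where "j = Suc J"
  have c: "4 * real j + 1 + 2 = 4 * real j + 3" "2 * real (2 * j) + 1 = 4 * real j + 1"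
    "4 * real j + 1 + 1 = 2 * (2 * real j + 1)" "2 * (2 * j) + 1 = 4 * j + 1"
    by simp_all
  have gen: "8 * (2 * x * h / y) - a - b - 16 * (l * (2 * x / y)) = 16 * (x * h / y) - a - b - 32 * (l * (x / y))"
    for x h y a b l :: real
    by simp
  have "arctan_moment_sum (2 * j + 1) = arctan_moment_sum (2 * J + 1)
      + (odd_quadratic_sum (Suc (2 * j)) - odd_quadratic_sum (2 * j))"
    using arctan_moment_sum_add_2[of "2 * J + 1"] by (simp add: j_def)
  also have "odd_quadratic_sum (Suc (2 * j)) - odd_quadratic_sum (2 * j) =
      16 * ((2 * real j + 1) * (2 * harm (4 * j + 1) - harm (2 * j)) / ((4 * real j + 3)\<^sup>2 * (4 * real j + 1)\<^sup>2))
      - 4 * (1 / (4 * real j + 3) ^ 3) - pi\<^sup>2 * (1 / 3 * (1 / ((4 * real j + 3) * (4 * real j + 1))))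
      - 32 * (ln 2 * ((2 * real j + 1) / ((4 * real j + 3)\<^sup>2 * (4 * real j + 1)\<^sup>2)))"
    unfolding odd_quadratic_sum_diff[of "2 * j"] c by (rule gen)
  moreover have "sum f {1..j} = sum f {1..J} + f j" for f :: "nat \<Rightarrow> real"
    by (simp add: j_def)
  ultimately show ?case unfolding Suc j_def[symmetric] by (simp only: ring_distribs)
qed

text \<open>The 4 in front of the moment cancels the square of 2 in the denominator. Counted by
  \<open>Suc (k + m)\<close>, the term involves \<open>n\<close> only through
  \<open>d\<close>.\<close>

lemma Theta1_summand_eq:
  "Theta1_summand m (m + d) (Suc k) = arctan_moment (Suc (k + m) + d + 1) / (real (Suc (k + m)))\<^sup>2"
proof -
  have "Theta1_summand m (m + d) (Suc k) = 4 * arctan_moment (Suc (Suc k + (m + d))) / (2 * real (Suc (k + m)))\<^sup>2"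
    using Digamma_diff_eq_arctan_moment[of "Suc k + (m + d)"] by (simp add: Theta1_summand_def add_ac)
  thus ?thesis by (simp add: power_mult_distrib add_ac del: of_nat_Suc)
qed

text \<open>After this reindexing the series starts at \<open>m + 1\<close>, so the first
  \<open>m\<close> terms of \<open>arctan_moment_sum d\<close> are taken away.\<close>

lemma Theta1_sums:
  "(\<lambda>k. Theta1_summand m (m + d) (Suc k)) sums
     (arctan_moment_sum d - (\<Sum>k=1..m. arctan_moment (k + d + 1) / (real k)\<^sup>2))"
proof -
  have "(\<Sum>k=1..m. arctan_moment (k + d + 1) / (real k)\<^sup>2)
      = (\<Sum>k<m. arctan_moment (Suc k + d + 1) / (real (Suc k))\<^sup>2)"
    by (rule sum.reindex_bij_witness[of _ Suc "\<lambda>k. k - 1"]) auto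
  thus ?thesis
    using sums_split_initial_segment[OF arctan_moment_sums[of d], of m] by (simp only: Theta1_summand_eq)
qed

lemma arctan_moment_partial_sum:
  "- (\<Sum>k=1..m. arctan_moment (k + d + 1) / (real k)\<^sup>2) =
     - (\<Sum>k=1..m. \<Sum>j=0..k + d. (-1) ^ (j + k + d) / ((real k)\<^sup>2 * (2 * real j + 1)))
     + (-1) ^ d * (\<Sum>k=1..m. (-1) ^ k / (4 * (real k)\<^sup>2)) * pi"
proof -
  have "- (arctan_moment (k + d + 1) / (real k)\<^sup>2) =
      - (\<Sum>j=0..k + d. (-1) ^ (j + k + d) / ((real k)\<^sup>2 * (2 * real j + 1)))
      + (-1) ^ d * ((-1) ^ k / (4 * (real k)\<^sup>2)) * pi" for k
  proof -
    define s where "s = (\<Sum>j=0..k + d. (-1) ^ j / (2 * real j + 1))"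
    \<comment> \<open>The \<open>+ 1\<close> in the moment index contributes the overall minus sign
      and makes the inner sum reach \<open>k + d\<close>.\<close>
    have "{..<k + d + 1} = {0..k + d}" by auto
    hence "arctan_moment (k + d + 1) = - ((-1) ^ k * (-1) ^ d * (pi / 4 - s))"
      by (simp add: arctan_moment_eq s_def power_add)
    moreover have "(\<Sum>j=0..k + d. (-1) ^ (j + k + d) / ((real k)\<^sup>2 * (2 * real j + 1)))
        = (-1) ^ k * (-1) ^ d / (real k)\<^sup>2 * s"
      unfolding s_def sum_distrib_left by (intro sum.cong refl) (simp add: power_add)
    ultimately show ?thesis by (simp add: diff_divide_distrib right_diff_distrib)
  qed
  thus ?thesis
    by (simp only: sum_negf[symmetric] sum.distrib sum_distrib_left sum_distrib_right)
qed

lemma Theta1_eq: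
  "Theta1 m (m + d) = arctan_moment_sum d
     - (\<Sum>k=1..m. \<Sum>j=0..k + d. (-1) ^ (j + k + d) / ((real k)\<^sup>2 * (2 * real j + 1)))
     + (-1) ^ d * (\<Sum>k=1..m. (-1) ^ k / (4 * (real k)\<^sup>2)) * pi"
  using Theta1_sums[of m d] arctan_moment_partial_sum[of d m] by (simp add: Theta1_def sums_iff)

section \<open>The four cases, governed by the parity of the difference\<close>

theorem theorem7:
  fixes m n :: nat
  assumes "m \<ge> 1" and "n \<ge> m"
  shows
    "summable (\<lambda>k. Theta1_summand m n (Suc k)) \<and>
    (n = m \<longrightarrow> Theta1 m n =
       - 4 - (\<Sum>k=1..m. \<Sum>j=0..k. (-1) ^ (k + j) / ((real k)\<^sup>2 * (2 * real j + 1)))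
       + 4 * ln 2
       - (1 / 2 * (ln 2)\<^sup>2 + (\<Sum>k=1..m. (-1) ^ (k - 1) / (4 * (real k)\<^sup>2))) * pi
       + pi\<^sup>2 / 6 - 11 * pi ^ 3 / 48 - 4 * catalan * ln 2 + 8 * Im (trilog (1 + \<i>))) \<and>
    (n = m + 1 \<longrightarrow> Theta1 m n =
       92 / 27 + (\<Sum>k=1..m. \<Sum>j=0..k + 1. (-1) ^ (k + j) / ((real k)\<^sup>2 * (2 * real j + 1)))
       + (1 / 2 * (ln 2)\<^sup>2 - (\<Sum>k=1..m. (-1) ^ k / (4 * (real k)\<^sup>2))) * pi
       - pi\<^sup>2 / 9 + 11 * pi ^ 3 / 48 + 4 * catalan * ln 2 - 32 * ln 2 / 9
       - 8 * Im (trilog (1 + \<i>))) \<and>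
    (odd (n - m) \<and> n - m \<noteq> 1 \<longrightarrow> Theta1 m n =
       92 / 27
       + 16 * (\<Sum>j=1..(n - m - 1) div 2.
           (2 * real j + 1) * (2 * harm (4 * j + 1) - harm (2 * j))
             / ((4 * real j + 3)\<^sup>2 * (4 * real j + 1)\<^sup>2))
       - 4 * (\<Sum>j=1..(n - m - 1) div 2. 1 / (4 * real j + 3) ^ 3)
       - (\<Sum>k=1..m. \<Sum>j=0..k + n - m.
           (-1) ^ (j + k + n - m) / ((real k)\<^sup>2 * (2 * real j + 1)))
       + (1 / 2 * (ln 2)\<^sup>2 + (-1) ^ (n - m) * (\<Sum>k=1..m. (-1) ^ k / (4 * (real k)\<^sup>2))) * pi
       - pi\<^sup>2 * (1 / 9 + 1 / 3 * (\<Sum>j=1..(n - m - 1) div 2.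
           1 / ((4 * real j + 3) * (4 * real j + 1))))
       - ln 2 * (32 / 9 + 32 * (\<Sum>j=1..(n - m - 1) div 2.
           (2 * real j + 1) / ((4 * real j + 3)\<^sup>2 * (4 * real j + 1)\<^sup>2)))
       + 11 * pi ^ 3 / 48 + 4 * catalan * ln 2 - 8 * Im (trilog (1 + \<i>))) \<and>
    (even (n - m) \<longrightarrow> Theta1 m n =
       - 4
       + 32 * (\<Sum>j<(n - m) div 2.
           (real j + 1) * (2 * harm (4 * j + 3) - harm (2 * j + 1))
             / ((4 * real j + 5)\<^sup>2 * (4 * real j + 3)\<^sup>2))
       - 4 * (\<Sum>j<(n - m) div 2. 1 / (4 * real j + 5) ^ 3)
       - (\<Sum>k=1..m. \<Sum>j=0..k + n - m.
           (-1) ^ (j + k + n - m) / ((real k)\<^sup>2 * (2 * real j + 1)))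
       + (- (1 / 2) * (ln 2)\<^sup>2 + (-1) ^ (n - m) * (\<Sum>k=1..m. (-1) ^ k / (4 * (real k)\<^sup>2))) * pi
       + pi\<^sup>2 * (1 / 6 - 1 / 3 * (\<Sum>j<(n - m) div 2.
           1 / ((4 * real j + 5) * (4 * real j + 3))))
       + ln 2 * (4 - 64 * (\<Sum>j<(n - m) div 2.
           (real j + 1) / ((4 * real j + 5)\<^sup>2 * (4 * real j + 3)\<^sup>2)))
       - 11 * pi ^ 3 / 48 - 4 * catalan * ln 2 + 8 * Im (trilog (1 + \<i>)))"
proof -
  obtain d where n: "n = m + d"
    using assms(2) by (auto simp: le_iff_add)
  have nm: "n - m = d" by (simp add: n)
  \<comment> \<open>These natural subtractions are exact because \<open>n = m + d\<close>.\<close>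
  have kn: "k + n - m = k + d" "j + k + n - m = j + k + d" for j k
    by (simp_all add: n)
  note Theta = Theta1_eq[of m d, folded n]
  have summable: "summable (\<lambda>k. Theta1_summand m n (Suc k))"
    unfolding n using Theta1_sums by (rule sums_summable)
  have even: "Theta1 m n =
       - 4
       + 32 * (\<Sum>j<d div 2.
           (real j + 1) * (2 * harm (4 * j + 3) - harm (2 * j + 1))
             / ((4 * real j + 5)\<^sup>2 * (4 * real j + 3)\<^sup>2))
       - 4 * (\<Sum>j<d div 2. 1 / (4 * real j + 5) ^ 3)
       - (\<Sum>k=1..m. \<Sum>j=0..k + d. (-1) ^ (j + k + d) / ((real k)\<^sup>2 * (2 * real j + 1)))
       + (- (1 / 2) * (ln 2)\<^sup>2 + (-1) ^ d * (\<Sum>k=1..m. (-1) ^ k / (4 * (real k)\<^sup>2))) * pi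
       + pi\<^sup>2 * (1 / 6 - 1 / 3 * (\<Sum>j<d div 2. 1 / ((4 * real j + 5) * (4 * real j + 3))))
       + ln 2 * (4 - 64 * (\<Sum>j<d div 2. (real j + 1) / ((4 * real j + 5)\<^sup>2 * (4 * real j + 3)\<^sup>2)))
       - 11 * pi ^ 3 / 48 - 4 * catalan * ln 2 + 8 * Im (trilog (1 + \<i>))" if "even d"
  proof -
    have "2 * (d div 2) = d" using that by simp
    \<comment> \<open>A regrouping in which \<open>pi * l / 2 + p + g - t\<close> stands for the
      value of the dilogarithm integral, subtracted in the even case.\<close>
    have "a + b - c + e + f - (pi * l / 2 + p + g - t) - s + x * pi
        = a + b - c - s + (- (1 / 2) * l + x) * pi + e + f - p - g + t" for a b c e f l p g t s x :: real
      by (simp add: field_simps)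
    thus ?thesis
      unfolding Theta arctan_moment_sum_even[of "d div 2", unfolded \<open>2 * (d div 2) = d\<close> dilog_arctan_integral] .
  qed
  have odd: "Theta1 m n =
       92 / 27
       + 16 * (\<Sum>j=1..(d - 1) div 2.
           (2 * real j + 1) * (2 * harm (4 * j + 1) - harm (2 * j))
             / ((4 * real j + 3)\<^sup>2 * (4 * real j + 1)\<^sup>2))
       - 4 * (\<Sum>j=1..(d - 1) div 2. 1 / (4 * real j + 3) ^ 3)
       - (\<Sum>k=1..m. \<Sum>j=0..k + d. (-1) ^ (j + k + d) / ((real k)\<^sup>2 * (2 * real j + 1)))
       + (1 / 2 * (ln 2)\<^sup>2 + (-1) ^ d * (\<Sum>k=1..m. (-1) ^ k / (4 * (real k)\<^sup>2))) * pi
       - pi\<^sup>2 * (1 / 9 + 1 / 3 * (\<Sum>j=1..(d - 1) div 2. 1 / ((4 * real j + 3) * (4 * real j + 1))))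
       - ln 2 * (32 / 9 + 32 * (\<Sum>j=1..(d - 1) div 2.
           (2 * real j + 1) / ((4 * real j + 3)\<^sup>2 * (4 * real j + 1)\<^sup>2)))
       + 11 * pi ^ 3 / 48 + 4 * catalan * ln 2 - 8 * Im (trilog (1 + \<i>))" if "odd d"
  proof -
    have "2 * ((d - 1) div 2) + 1 = d" using that by simp
    have "a + b - c - e - f + (pi * l / 2 + p + g - t) - s + x * pi
        = a + b - c - s + (1 / 2 * l + x) * pi - e - f + p + g - t" for a b c e f l p g t s x :: real
      by (simp add: field_simps)
    thus ?thesis
      unfolding Theta arctan_moment_sum_odd[of "(d - 1) div 2", unfolded \<open>2 * ((d - 1) div 2) + 1 = d\<close> dilog_arctan_integral] .
  qed
  have sign: "(\<Sum>k=1..m. (-1) ^ (k - 1) / (4 * (real k)\<^sup>2)) = - (\<Sum>k=1..m. (-1) ^ k / (4 * (real k)\<^sup>2))"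
  proof -
    \<comment> \<open>The range starts at 1, so \<open>k - 1\<close> is a genuine
      predecessor.\<close>
    have "(-1) ^ (k - 1) / (4 * (real k)\<^sup>2) = - ((-1) ^ k / (4 * (real k)\<^sup>2))" if "k \<in> {1..m}" for k
      using that by (cases k) auto
    thus ?thesis by (simp only: sum_negf[symmetric] cong: sum.cong)
  qed
  have equal: "Theta1 m n =
       - 4 - (\<Sum>k=1..m. \<Sum>j=0..k. (-1) ^ (k + j) / ((real k)\<^sup>2 * (2 * real j + 1)))
       + 4 * ln 2
       - (1 / 2 * (ln 2)\<^sup>2 + (\<Sum>k=1..m. (-1) ^ (k - 1) / (4 * (real k)\<^sup>2))) * pi
       + pi\<^sup>2 / 6 - 11 * pi ^ 3 / 48 - 4 * catalan * ln 2 + 8 * Im (trilog (1 + \<i>))" if "n = m"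
  proof -
    \<comment> \<open>The even formula with all sums over \<open>j<d div 2\<close> empty.\<close>
    have d: "d = 0" using that n by simp
    show ?thesis
      using even unfolding d sign by (simp add: left_diff_distrib distrib_right add.commute)
  qed
  have succ: "Theta1 m n =
       92 / 27 + (\<Sum>k=1..m. \<Sum>j=0..k + 1. (-1) ^ (k + j) / ((real k)\<^sup>2 * (2 * real j + 1)))
       + (1 / 2 * (ln 2)\<^sup>2 - (\<Sum>k=1..m. (-1) ^ k / (4 * (real k)\<^sup>2))) * pi
       - pi\<^sup>2 / 9 + 11 * pi ^ 3 / 48 + 4 * catalan * ln 2 - 32 * ln 2 / 9
       - 8 * Im (trilog (1 + \<i>))" if "n = m + 1"
  proof -
    \<comment> \<open>The odd formula with all sums up to \<open>(d - 1) div 2\<close> empty; the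
      odd \<open>d\<close> flips the sign of the double sum.\<close>
    have d: "d = 1" using that n by simp
    have "(\<Sum>k=1..m. \<Sum>j=0..k + 1. (-1) ^ (j + k + 1) / ((real k)\<^sup>2 * (2 * real j + 1)))
        = - (\<Sum>k=1..m. \<Sum>j=0..k + 1. (-1) ^ (k + j) / ((real k)\<^sup>2 * (2 * real j + 1)))"
      by (simp only: sum_negf[symmetric]) (simp add: add.commute)
    thus ?thesis using odd unfolding d by simp
  qed
  show ?thesis
  proof (intro conjI impI, goal_cases)
    case 1
    show ?case by (rule summable)
  next
    case 2
    thus ?case by (rule equal)
  next
    case 3
    thus ?case by (rule succ)
  next
    case 4
    thus ?case unfolding nm kn by (intro odd) simp
  next
    case 5
    thus ?case unfolding nm kn by (rule even)
  qed
qed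

end
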